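(* Let $(\mathfrak g,\omega)$ be a symplectic Lie algebra with $\mathfrak g$ isomorphic either to $\mathfrak r'_{4,0,\delta}$ or to $\mathfrak d'_{4,\delta}$ for some $\delta>0$. Then $\mathfrak g$ is a generalized symplectic double extension of $\mathbb R^2$ by $\mathbb R$.
   Context: A symplectic form on a $2n$-dimensional real Lie algebra is a closed (Chevalley–Eilenberg, trivial coefficients) 2-form $\omega$ with $\omega^n\neq0$. For a subspace $W$, $W^\perp=\{x\in\mathfrak g:\omega(x,y)=0\ \forall y\in W\}$, and $W$ is isotropic if $W\subset W^\perp$. The Lie algebras have basis $e_1,\dots,e_4$ and nonzero brackets: $\mathfrak r'_{4,0,\delta}$: $[e_4,e_1]=e_1$, $[e_4,e_2]=-\delta e_3$, $[e_4,e_3]=\delta e_2$; $\mathfrak d'_{4,\delta}$: $[e_1,e_2]=e_3$, $[e_4,e_1]=\frac\delta2e_1-e_2$, $[e_4,e_2]=e_1+\frac\delta2e_2$, $[e_4,e_3]=\delta e_3$. Generalized symplectic double extensions are characterized as follows: $(\mathfrak g,\omega)$ is a generalized symplectic double extension of a symplectic Lie algebra $B$ by a Lie algebra $V$ if there is an isotropic ideal $\mathfrak h$ of $\mathfrak g$ such that $\mathfrak h^\perp$ is an ideal of $\mathfrak g$, the exact sequence of Lie algebras $0\to\mathfrak h^\perp/\mathfrak h\to\mathfrak g/\mathfrak h\to\mathfrak g/\mathfrak h^\perp\to0$ splits, $\mathfrak h^\perp/\mathfrak h$ with the symplectic form induced by $\omega$ is isomorphic to $B$, and $\mathfrak g/\mathfrak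 h^\perp\cong V$. Here $\mathbb R^2$ is the abelian Lie algebra with its (unique up to isomorphism) symplectic form, and $\mathbb R$ is the one-dimensional Lie algebra. *)

theory Defs
  imports "HOL-Algebra.QuotRing" "Jordan_Normal_Form.VS_Connect" "HOL-Combinatorics.Permutations"
begin

section \<open>Real Lie algebras\<close>

text \<open>
  A Lie algebra is a module record over the field \<^term>\<open>class_ring :: real ring\<close> whose
  multiplication field holds the Lie bracket, i.e. \<open>x \<otimes>\<^bsub>L\<^esub> y\<close> is read as \<open>[x, y]\<close>.  The unit field of
  the record has no meaning for Lie algebras and is never constrained.
\<close>

locale lie_algebra = vectorspace "class_ring :: real ring" L
  for L :: "(real, 'a) module" +
  assumes bracket_closed:
      "\<lbrakk>x \<in> carrier L; y \<in> carrier L\<rbrakk> \<Longrightarrow> x \<otimes>\<^bsub>L\<^esub> y \<in> carrier L"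
    and bracket_add_left:
      "\<lbrakk>x \<in> carrier L; y \<in> carrier L; z \<in> carrier L\<rbrakk>
        \<Longrightarrow> (x \<oplus>\<^bsub>L\<^esub> y) \<otimes>\<^bsub>L\<^esub> z = (x \<otimes>\<^bsub>L\<^esub> z) \<oplus>\<^bsub>L\<^esub> (y \<otimes>\<^bsub>L\<^esub> z)"
    and bracket_add_right:
      "\<lbrakk>x \<in> carrier L; y \<in> carrier L; z \<in> carrier L\<rbrakk>
        \<Longrightarrow> x \<otimes>\<^bsub>L\<^esub> (y \<oplus>\<^bsub>L\<^esub> z) = (x \<otimes>\<^bsub>L\<^esub> y) \<oplus>\<^bsub>L\<^esub> (x \<otimes>\<^bsub>L\<^esub> z)"
    and bracket_smult_left:
      "\<lbrakk>x \<in> carrier L; y \<in> carrier L\<rbrakk> \<Longrightarrow> (c \<odot>\<^bsub>L\<^esub> x) \<otimes>\<^bsub>L\<^esub> y = c \<odot>\<^bsub>L\<^esub> (x \<otimes>\<^bsub>L\<^esub> y)"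
    and bracket_smult_right:
      "\<lbrakk>x \<in> carrier L; y \<in> carrier L\<rbrakk> \<Longrightarrow> x \<otimes>\<^bsub>L\<^esub> (c \<odot>\<^bsub>L\<^esub> y) = c \<odot>\<^bsub>L\<^esub> (x \<otimes>\<^bsub>L\<^esub> y)"
    and bracket_alternating:
      "x \<in> carrier L \<Longrightarrow> x \<otimes>\<^bsub>L\<^esub> x = \<zero>\<^bsub>L\<^esub>"
    and jacobi:
      "\<lbrakk>x \<in> carrier L; y \<in> carrier L; z \<in> carrier L\<rbrakk>
        \<Longrightarrow> (x \<otimes>\<^bsub>L\<^esub> (y \<otimes>\<^bsub>L\<^esub> z)) \<oplus>\<^bsub>L\<^esub> ((y \<otimes>\<^bsub>L\<^esub> (z \<otimes>\<^bsub>L\<^esub> x)) \<oplus>\<^bsub>L\<^esub> (z \<otimes>\<^bsub>L\<^esub> (x \<otimes>\<^bsub>L\<^esub> y))) = \<zero>\<^bsub>L\<^esub>"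

definition lie_hom :: "(real, 'a) module \<Rightarrow> (real, 'b) module \<Rightarrow> ('a \<Rightarrow> 'b) set" where
  "lie_hom L M = {f \<in> LinearCombinations.module_hom class_ring L M.
     \<forall>x\<in>carrier L. \<forall>y\<in>carrier L. f (x \<otimes>\<^bsub>L\<^esub> y) = f x \<otimes>\<^bsub>M\<^esub> f y}"

definition lie_iso :: "(real, 'a) module \<Rightarrow> (real, 'b) module \<Rightarrow> ('a \<Rightarrow> 'b) set" where
  "lie_iso L M = {f \<in> lie_hom L M. bij_betw f (carrier L) (carrier M)}"

definition lie_isomorphic :: "(real, 'a) module \<Rightarrow> (real, 'b) module \<Rightarrow> bool" where
  "lie_isomorphic L M \<longleftrightarrow> lie_iso L M \<noteq> {}"

definition lie_ideal :: "(real, 'a) module \<Rightarrow> 'a set \<Rightarrow> bool" where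
  "lie_ideal L I \<longleftrightarrow> VectorSpace.subspace class_ring I L \<and> (\<forall>x\<in>carrier L. \<forall>y\<in>I. x \<otimes>\<^bsub>L\<^esub> y \<in> I)"

text \<open>The additive and bracket structure on the cosets is that of \<^const>\<open>FactRing\<close>.\<close>

definition lie_quotient :: "(real, 'a) module \<Rightarrow> 'a set \<Rightarrow> (real, 'a set) module" where
  "lie_quotient L I =
     \<lparr>carrier = a_rcosets\<^bsub>L\<^esub> I, mult = rcoset_mult L I, one = I +>\<^bsub>L\<^esub> \<one>\<^bsub>L\<^esub>,
      zero = I, add = set_add L, smult = (\<lambda>c X. \<Union>x\<in>X. I +>\<^bsub>L\<^esub> (c \<odot>\<^bsub>L\<^esub> x))\<rparr>"

text \<open>
  The sequence \<open>0 \<rightarrow> A \<rightarrow> B \<rightarrow> C \<rightarrow> 0\<close> with maps \<open>i\<close> and \<open>p\<close> is an exact sequence of Lie algebras, and it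
  splits: \<open>p\<close> has a section that is a Lie algebra homomorphism.
\<close>

definition lie_split_exact ::
    "(real, 'a) module \<Rightarrow> ('a \<Rightarrow> 'b) \<Rightarrow> (real, 'b) module \<Rightarrow> ('b \<Rightarrow> 'c) \<Rightarrow> (real, 'c) module \<Rightarrow> bool" where
  "lie_split_exact A i B p C \<longleftrightarrow>
     i \<in> lie_hom A B \<and> p \<in> lie_hom B C \<and>
     inj_on i (carrier A) \<and>
     i ` carrier A = {x \<in> carrier B. p x = \<zero>\<^bsub>C\<^esub>} \<and>
     p ` carrier B = carrier C \<and>
     (\<exists>s\<in>lie_hom C B. \<forall>x\<in>carrier C. p (s x) = x)"


section \<open>Symplectic forms\<close>

definition two_form :: "(real, 'a) module \<Rightarrow> ('a \<Rightarrow> 'a \<Rightarrow> real) \<Rightarrow> bool" where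
  "two_form L \<omega> \<longleftrightarrow>
     (\<forall>x\<in>carrier L. \<forall>y\<in>carrier L. \<forall>z\<in>carrier L. \<omega> (x \<oplus>\<^bsub>L\<^esub> y) z = \<omega> x z + \<omega> y z) \<and>
     (\<forall>x\<in>carrier L. \<forall>y\<in>carrier L. \<forall>z\<in>carrier L. \<omega> x (y \<oplus>\<^bsub>L\<^esub> z) = \<omega> x y + \<omega> x z) \<and>
     (\<forall>c. \<forall>x\<in>carrier L. \<forall>y\<in>carrier L. \<omega> (c \<odot>\<^bsub>L\<^esub> x) y = c * \<omega> x y) \<and>
     (\<forall>c. \<forall>x\<in>carrier L. \<forall>y\<in>carrier L. \<omega> x (c \<odot>\<^bsub>L\<^esub> y) = c * \<omega> x y) \<and>
     (\<forall>x\<in>carrier L. \<omega> x x = 0)"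

text \<open>Chevalley--Eilenberg differential of a 2-form, with trivial coefficients.\<close>

definition ce_differential2 ::
    "(real, 'a) module \<Rightarrow> ('a \<Rightarrow> 'a \<Rightarrow> real) \<Rightarrow> 'a \<Rightarrow> 'a \<Rightarrow> 'a \<Rightarrow> real" where
  "ce_differential2 L \<omega> x y z = - \<omega> (x \<otimes>\<^bsub>L\<^esub> y) z + \<omega> (x \<otimes>\<^bsub>L\<^esub> z) y - \<omega> (y \<otimes>\<^bsub>L\<^esub> z) x"

definition ce_closed2 :: "(real, 'a) module \<Rightarrow> ('a \<Rightarrow> 'a \<Rightarrow> real) \<Rightarrow> bool" where
  "ce_closed2 L \<omega> \<longleftrightarrow>
     (\<forall>x\<in>carrier L. \<forall>y\<in>carrier L. \<forall>z\<in>carrier L. ce_differential2 L \<omega> x y z = 0)"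

text \<open>
  For exterior powers, a \<open>k\<close>-form is a function of a sequence of vectors that depends on the entries
  \<open>0, \<dots>, k - 1\<close> only.  The wedge product of a \<open>p\<close>-form and a \<open>q\<close>-form uses the normalisation
  \<open>1 / (p! q!)\<close>.
\<close>

definition wedge ::
    "nat \<Rightarrow> nat \<Rightarrow> ((nat \<Rightarrow> 'a) \<Rightarrow> real) \<Rightarrow> ((nat \<Rightarrow> 'a) \<Rightarrow> real) \<Rightarrow> (nat \<Rightarrow> 'a) \<Rightarrow> real" where
  "wedge p q \<alpha> \<beta> v =
     (\<Sum>\<sigma> | \<sigma> permutes {..<p + q}.
        of_int (sign \<sigma>) * \<alpha> (\<lambda>i. v (\<sigma> i)) * \<beta> (\<lambda>i. v (\<sigma> (p + i)))) / (fact p * fact q)"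

primrec two_form_power :: "('a \<Rightarrow> 'a \<Rightarrow> real) \<Rightarrow> nat \<Rightarrow> (nat \<Rightarrow> 'a) \<Rightarrow> real" where
  "two_form_power \<omega> 0 = (\<lambda>v. 1)"
| "two_form_power \<omega> (Suc n) = wedge 2 (2 * n) (\<lambda>v. \<omega> (v 0) (v 1)) (two_form_power \<omega> n)"

definition symplectic_form :: "(real, 'a) module \<Rightarrow> ('a \<Rightarrow> 'a \<Rightarrow> real) \<Rightarrow> bool" where
  "symplectic_form L \<omega> \<longleftrightarrow>
     two_form L \<omega> \<and> ce_closed2 L \<omega> \<and>
     vectorspace.fin_dim class_ring L \<and>
     (\<exists>n. vectorspace.dim class_ring L = 2 * n \<and>
          (\<exists>v\<in>{..<2 * n} \<rightarrow> carrier L. two_form_power \<omega> n v \<noteq> 0))"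

definition symplectic_lie_algebra :: "(real, 'a) module \<Rightarrow> ('a \<Rightarrow> 'a \<Rightarrow> real) \<Rightarrow> bool" where
  "symplectic_lie_algebra L \<omega> \<longleftrightarrow> lie_algebra L \<and> symplectic_form L \<omega>"

definition symplectic_isomorphic ::
    "(real, 'a) module \<Rightarrow> ('a \<Rightarrow> 'a \<Rightarrow> real) \<Rightarrow> (real, 'b) module \<Rightarrow> ('b \<Rightarrow> 'b \<Rightarrow> real) \<Rightarrow> bool" where
  "symplectic_isomorphic L \<omega> M \<omega>' \<longleftrightarrow>
     (\<exists>f\<in>lie_iso L M. \<forall>x\<in>carrier L. \<forall>y\<in>carrier L. \<omega>' (f x) (f y) = \<omega> x y)"

definition perp :: "(real, 'a) module \<Rightarrow> ('a \<Rightarrow> 'a \<Rightarrow> real) \<Rightarrow> 'a set \<Rightarrow> 'a set" where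
  "perp L \<omega> W = {x \<in> carrier L. \<forall>y\<in>W. \<omega> x y = 0}"

definition isotropic :: "(real, 'a) module \<Rightarrow> ('a \<Rightarrow> 'a \<Rightarrow> real) \<Rightarrow> 'a set \<Rightarrow> bool" where
  "isotropic L \<omega> W \<longleftrightarrow> W \<subseteq> perp L \<omega> W"

text \<open>The form induced on cosets: the common value of \<open>\<omega>\<close> on all pairs of representatives.\<close>

definition induced_form :: "('a \<Rightarrow> 'a \<Rightarrow> real) \<Rightarrow> 'a set \<Rightarrow> 'a set \<Rightarrow> real" where
  "induced_form \<omega> X Y = (THE r. \<forall>x\<in>X. \<forall>y\<in>Y. \<omega> x y = r)"


section \<open>Generalized symplectic double extensions\<close>

text \<open>
  In the exact sequence \<open>0 \<rightarrow> \<hh>\<^sup>\<bottom>/\<hh> \<rightarrow> \<gg>/\<hh> \<rightarrow> \<gg>/\<hh>\<^sup>\<bottom> \<rightarrow> 0\<close> the first map is the inclusion of cosets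
  and the second sends \<open>\<hh> + x\<close> to \<open>\<hh>\<^sup>\<bottom> + (\<hh> + x) = \<hh>\<^sup>\<bottom> + x\<close>.
\<close>

definition generalized_symplectic_double_extension ::
    "(real, 'a) module \<Rightarrow> ('a \<Rightarrow> 'a \<Rightarrow> real) \<Rightarrow>
     (real, 'b) module \<Rightarrow> ('b \<Rightarrow> 'b \<Rightarrow> real) \<Rightarrow> (real, 'c) module \<Rightarrow> bool" where
  "generalized_symplectic_double_extension G \<omega> B \<omega>\<^sub>B V \<longleftrightarrow>
     symplectic_lie_algebra G \<omega> \<and> symplectic_lie_algebra B \<omega>\<^sub>B \<and> lie_algebra V \<and>
     (\<exists>H. lie_ideal G H \<and> isotropic G \<omega> H \<and> lie_ideal G (perp G \<omega> H) \<and>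
        lie_split_exact
          (lie_quotient (G\<lparr>carrier := perp G \<omega> H\<rparr>) H) (\<lambda>X. X)
          (lie_quotient G H) (\<lambda>X. perp G \<omega> H <+>\<^bsub>G\<^esub> X)
          (lie_quotient G (perp G \<omega> H)) \<and>
        symplectic_isomorphic
          (lie_quotient (G\<lparr>carrier := perp G \<omega> H\<rparr>) H) (induced_form \<omega>) B \<omega>\<^sub>B \<and>
        lie_isomorphic (lie_quotient G (perp G \<omega> H)) V)"


section \<open>The Lie algebras of the statement\<close>

text \<open>
  \<open>lie_from_table n b\<close> is \<open>\<real>\<^sup>n\<close> with the bilinear antisymmetric bracket determined by
  \<open>[e\<^sub>i, e\<^sub>j] = b i j - b j i\<close>, so a table lists each nonzero bracket for only one order of its
  arguments.  The indices of \<open>b\<close> run over \<open>1, \<dots>, n\<close>, whereas vector entries are indexed from \<open>0\<close>.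
\<close>

definition basis4 :: "nat \<Rightarrow> real vec" (\<open>\<e>\<close>) where
  "basis4 i = unit_vec 4 (i - 1)"

definition lie_from_table :: "nat \<Rightarrow> (nat \<Rightarrow> nat \<Rightarrow> real vec) \<Rightarrow> (real, real vec) module" where
  "lie_from_table n b = (module_vec TYPE(real) n)
     \<lparr>mult := \<lambda>x y. vec n (\<lambda>k. \<Sum>i=1..n. \<Sum>j=1..n.
        x $ (i - 1) * y $ (j - 1) * (b i j $ k - b j i $ k))\<rparr>"

definition r'_4_0 :: "real \<Rightarrow> (real, real vec) module" where
  "r'_4_0 \<delta> = lie_from_table 4 (\<lambda>i j.
     if (i, j) = (4, 1) then \<e> 1
     else if (i, j) = (4, 2) then (- \<delta>) \<cdot>\<^sub>v \<e> 3
     else if (i, j) = (4, 3) then \<delta> \<cdot>\<^sub>v \<e> 2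
     else 0\<^sub>v 4)"

definition d'_4 :: "real \<Rightarrow> (real, real vec) module" where
  "d'_4 \<delta> = lie_from_table 4 (\<lambda>i j.
     if (i, j) = (1, 2) then \<e> 3
     else if (i, j) = (4, 1) then (\<delta> / 2) \<cdot>\<^sub>v \<e> 1 - \<e> 2
     else if (i, j) = (4, 2) then \<e> 1 + (\<delta> / 2) \<cdot>\<^sub>v \<e> 2
     else if (i, j) = (4, 3) then \<delta> \<cdot>\<^sub>v \<e> 3
     else 0\<^sub>v 4)"

definition abelian_lie :: "nat \<Rightarrow> (real, real vec) module" where
  "abelian_lie n = (module_vec TYPE(real) n)\<lparr>mult := \<lambda>x y. 0\<^sub>v n\<rparr>"

definition standard_form2 :: "real vec \<Rightarrow> real vec \<Rightarrow> real" where
  "standard_form2 x y = x $ 0 * y $ 1 - x $ 1 * y $ 0"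

end

theory Submission
  imports Defs
begin

text \<open>
  In both families the algebra is a semidirect product of the hyperplane \<open>K\<close> spanned by \<open>e\<^sub>1\<close>, \<open>e\<^sub>2\<close>,
  \<open>e\<^sub>3\<close> with the line of \<open>e\<^sub>4\<close>, and \<open>e\<^sub>4\<close> acts on \<open>K\<close> with one real eigenline \<open>\<hh>\<close> and a rotating plane.
  The eigenline is spanned by \<open>e\<^sub>1\<close> for \<open>\<rr>'\<^sub>4\<^sub>,\<^sub>0\<^sub>,\<^sub>\<delta>\<close> and by \<open>e\<^sub>3\<close> for \<open>\<dd>'\<^sub>4\<^sub>,\<^sub>\<delta>\<close>.  Whatever the
  symplectic form is, closedness forces \<open>\<hh>\<close> to be orthogonal to the rotating plane: the pairing of \<open>\<hh>\<close>
  with that plane is a functional that vanishes after composition with an operator without real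
  eigenvalues, and such an operator is onto.  So \<open>\<hh>\<^sup>\<bottom>\<close> contains \<open>K\<close>, and nondegeneracy makes them
  equal.  Both \<open>\<hh>\<close> and \<open>K\<close> are ideals and \<open>[K, K] \<subseteq> \<hh>\<close>, so \<open>\<hh>\<^sup>\<bottom>/\<hh>\<close> is an abelian symplectic plane.
  The sequence splits because its last term is one-dimensional.

  Lemma \<open>double_extension_hyperplane\<close> carries out this reduction for an arbitrary algebra with suitable
  functionals; it rests on \<open>coset_map_iso\<close> and \<open>split_exact_hyperplane\<close>.  Nondegeneracy is only
  available as \<open>\<omega>\<^sup>2 \<noteq> 0\<close>, a sum over permutations; \<open>pfaffian_nonzero\<close> turns it into the nonvanishing
  of the Pfaffian of \<open>\<omega>\<close> in a basis.  The two lemmas \<open>double_extension_r'_4_0\<close> and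
  \<open>double_extension_d'_4\<close> solve the closedness equations in coordinates.
\<close>

section \<open>Homomorphisms and cosets\<close>

definition linear_functional :: "(real, 'a) module \<Rightarrow> ('a \<Rightarrow> real) \<Rightarrow> bool" where
  "linear_functional L \<phi> \<longleftrightarrow>
     (\<forall>x\<in>carrier L. \<forall>y\<in>carrier L. \<phi> (x \<oplus>\<^bsub>L\<^esub> y) = \<phi> x + \<phi> y) \<and>
     (\<forall>c. \<forall>x\<in>carrier L. \<phi> (c \<odot>\<^bsub>L\<^esub> x) = c * \<phi> x)"

lemma lie_homI:
  assumes "\<And>x. x \<in> carrier L \<Longrightarrow> f x \<in> carrier M"
    and "\<And>x y. \<lbrakk>x \<in> carrier L; y \<in> carrier L\<rbrakk> \<Longrightarrow> f (x \<oplus>\<^bsub>L\<^esub> y) = f x \<oplus>\<^bsub>M\<^esub> f y"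
    and "\<And>c x. x \<in> carrier L \<Longrightarrow> f (c \<odot>\<^bsub>L\<^esub> x) = c \<odot>\<^bsub>M\<^esub> f x"
    and "\<And>x y. \<lbrakk>x \<in> carrier L; y \<in> carrier L\<rbrakk> \<Longrightarrow> f (x \<otimes>\<^bsub>L\<^esub> y) = f x \<otimes>\<^bsub>M\<^esub> f y"
  shows "f \<in> lie_hom L M"
  using assms unfolding lie_hom_def LinearCombinations.module_hom_def by auto

lemma lie_homD:
  assumes "f \<in> lie_hom L M"
  shows lie_hom_closed: "x \<in> carrier L \<Longrightarrow> f x \<in> carrier M"
    and lie_hom_add: "\<lbrakk>x \<in> carrier L; y \<in> carrier L\<rbrakk> \<Longrightarrow> f (x \<oplus>\<^bsub>L\<^esub> y) = f x \<oplus>\<^bsub>M\<^esub> f y"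
    and lie_hom_smult: "x \<in> carrier L \<Longrightarrow> f (c \<odot>\<^bsub>L\<^esub> x) = c \<odot>\<^bsub>M\<^esub> f x"
    and lie_hom_bracket:
      "\<lbrakk>x \<in> carrier L; y \<in> carrier L\<rbrakk> \<Longrightarrow> f (x \<otimes>\<^bsub>L\<^esub> y) = f x \<otimes>\<^bsub>M\<^esub> f y"
  using assms unfolding lie_hom_def LinearCombinations.module_hom_def by auto

context lie_algebra
begin

lemma smult_carrier [simp, intro]: "x \<in> carrier L \<Longrightarrow> c \<odot>\<^bsub>L\<^esub> x \<in> carrier L"
  by (simp add: smult_closed)

lemma bracket_carrier [simp, intro]:
  "\<lbrakk>x \<in> carrier L; y \<in> carrier L\<rbrakk> \<Longrightarrow> x \<otimes>\<^bsub>L\<^esub> y \<in> carrier L"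
  by (rule bracket_closed)

lemma smult_zero [simp]: "x \<in> carrier L \<Longrightarrow> 0 \<odot>\<^bsub>L\<^esub> x = \<zero>\<^bsub>L\<^esub>"
  using lmult_0[of x] by simp

lemma smult_minus_one: "x \<in> carrier L \<Longrightarrow> (- 1) \<odot>\<^bsub>L\<^esub> x = \<ominus>\<^bsub>L\<^esub> x"
  using smult_minus_1[of x] by (simp add: class_ring_simps)

text \<open>
  Polarisation: expand \<open>[x + y, x + y] = 0\<close>.
\<close>

lemma bracket_flip:
  assumes x: "x \<in> carrier L" and y: "y \<in> carrier L"
  shows "x \<otimes>\<^bsub>L\<^esub> y = (- 1) \<odot>\<^bsub>L\<^esub> (y \<otimes>\<^bsub>L\<^esub> x)"
proof -
  have "\<zero>\<^bsub>L\<^esub> = (x \<oplus>\<^bsub>L\<^esub> y) \<otimes>\<^bsub>L\<^esub> (x \<oplus>\<^bsub>L\<^esub> y)"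
    using x y by (simp add: bracket_alternating)
  also have "\<dots> = (x \<otimes>\<^bsub>L\<^esub> y) \<oplus>\<^bsub>L\<^esub> (y \<otimes>\<^bsub>L\<^esub> x)"
    using x y bracket_alternating[OF x] bracket_alternating[OF y]
    by (subst bracket_add_left) (simp_all add: bracket_add_right)
  finally show ?thesis
    using x y by (metis bracket_carrier smult_minus_one minus_equality)
qed

lemma functional_zero: "linear_functional L \<phi> \<Longrightarrow> \<phi> \<zero>\<^bsub>L\<^esub> = 0"
  unfolding linear_functional_def by (metis smult_zero zero_closed mult_zero_left)

lemma lie_idealI:
  assumes "I \<subseteq> carrier L" "\<zero>\<^bsub>L\<^esub> \<in> I"
    and "\<And>x y. \<lbrakk>x \<in> I; y \<in> I\<rbrakk> \<Longrightarrow> x \<oplus>\<^bsub>L\<^esub> y \<in> I"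
    and "\<And>c x. x \<in> I \<Longrightarrow> c \<odot>\<^bsub>L\<^esub> x \<in> I"
    and "\<And>x y. \<lbrakk>x \<in> carrier L; y \<in> I\<rbrakk> \<Longrightarrow> x \<otimes>\<^bsub>L\<^esub> y \<in> I"
  shows "lie_ideal L I"
  unfolding lie_ideal_def VectorSpace.subspace_def submodule_def
  using assms by (auto intro: vectorspace_axioms module_axioms)

end

locale lie_algebra_ideal = lie_algebra L for L :: "(real, 'a) module" +
  fixes I :: "'a set"
  assumes ideal: "lie_ideal L I"
begin

lemma ideal_submodule: "submodule class_ring I L"
  using ideal unfolding lie_ideal_def VectorSpace.subspace_def by auto

lemma ideal_carrier: "x \<in> I \<Longrightarrow> x \<in> carrier L"
  and ideal_zero: "\<zero>\<^bsub>L\<^esub> \<in> I"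
  and ideal_add: "\<lbrakk>x \<in> I; y \<in> I\<rbrakk> \<Longrightarrow> x \<oplus>\<^bsub>L\<^esub> y \<in> I"
  and ideal_smult: "x \<in> I \<Longrightarrow> c \<odot>\<^bsub>L\<^esub> x \<in> I"
  using ideal_submodule unfolding submodule_def by auto

lemma ideal_bracket_right: "\<lbrakk>x \<in> carrier L; y \<in> I\<rbrakk> \<Longrightarrow> x \<otimes>\<^bsub>L\<^esub> y \<in> I"
  using ideal unfolding lie_ideal_def by auto

lemma ideal_bracket_left: "\<lbrakk>x \<in> I; y \<in> carrier L\<rbrakk> \<Longrightarrow> x \<otimes>\<^bsub>L\<^esub> y \<in> I"
  using bracket_flip ideal_bracket_right ideal_smult ideal_carrier by metis

lemma ideal_uminus: "x \<in> I \<Longrightarrow> \<ominus>\<^bsub>L\<^esub> x \<in> I"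
  using smult_minus_one ideal_smult ideal_carrier by metis

sublocale cosets: abelian_subgroup I L
proof (rule abelian_subgroupI3)
  show "additive_subgroup I L"
    by (rule additive_subgroupI, rule add.subgroupI)
       (use ideal_carrier ideal_zero ideal_add ideal_uminus in auto)
qed (rule abelian_group_axioms)

text \<open>
  Ideals are given below by set comprehensions over the carrier.  Rewriting membership with such an
  equation produces a carrier condition, which this rule would turn back into membership: a loop.
\<close>

declare cosets.a_Hcarr [simp del]

lemma quotient_simps:
  "carrier (lie_quotient L I) = (\<lambda>x. I +>\<^bsub>L\<^esub> x) ` carrier L"
  "\<zero>\<^bsub>lie_quotient L I\<^esub> = I"
  by (auto simp: lie_quotient_def A_RCOSETS_def')

lemma coset_mem_iff:
  "y \<in> I +>\<^bsub>L\<^esub> x \<longleftrightarrow> (\<exists>h\<in>I. y = h \<oplus>\<^bsub>L\<^esub> x)"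
  by (auto simp: a_r_coset_def')

lemma coset_mem_diff:
  "\<lbrakk>x \<in> carrier L; y \<in> carrier L\<rbrakk> \<Longrightarrow> y \<in> I +>\<^bsub>L\<^esub> x \<longleftrightarrow> y \<oplus>\<^bsub>L\<^esub> (- 1) \<odot>\<^bsub>L\<^esub> x \<in> I"
  by (simp add: cosets.a_rcos_module smult_minus_one)

lemma coset_add:
  "\<lbrakk>x \<in> carrier L; y \<in> carrier L\<rbrakk> \<Longrightarrow>
     (I +>\<^bsub>L\<^esub> x) \<oplus>\<^bsub>lie_quotient L I\<^esub> (I +>\<^bsub>L\<^esub> y) = I +>\<^bsub>L\<^esub> (x \<oplus>\<^bsub>L\<^esub> y)"
  by (simp add: lie_quotient_def cosets.a_rcos_sum)

text \<open>
  Changing representatives, \<open>[h + x, k + y] = ([h, k + y] + [x, k]) + [x, y]\<close>, and the first two terms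
  lie in the ideal.
\<close>

lemma coset_bracket:
  assumes x: "x \<in> carrier L" and y: "y \<in> carrier L"
  shows "(I +>\<^bsub>L\<^esub> x) \<otimes>\<^bsub>lie_quotient L I\<^esub> (I +>\<^bsub>L\<^esub> y) = I +>\<^bsub>L\<^esub> (x \<otimes>\<^bsub>L\<^esub> y)"
proof -
  have "I +>\<^bsub>L\<^esub> (a \<otimes>\<^bsub>L\<^esub> b) = I +>\<^bsub>L\<^esub> (x \<otimes>\<^bsub>L\<^esub> y)"
    if ab: "a \<in> I +>\<^bsub>L\<^esub> x" "b \<in> I +>\<^bsub>L\<^esub> y" for a b
  proof -
    obtain h k where h: "h \<in> I" "a = h \<oplus>\<^bsub>L\<^esub> x" and k: "k \<in> I" "b = k \<oplus>\<^bsub>L\<^esub> y"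
      using ab x y by (auto simp: coset_mem_iff)
    have hk: "h \<in> carrier L" "k \<in> carrier L"
      using h k ideal_carrier by auto
    have "a \<otimes>\<^bsub>L\<^esub> b = ((h \<otimes>\<^bsub>L\<^esub> b) \<oplus>\<^bsub>L\<^esub> (x \<otimes>\<^bsub>L\<^esub> k)) \<oplus>\<^bsub>L\<^esub> (x \<otimes>\<^bsub>L\<^esub> y)"
      using h k hk x y by (simp add: bracket_add_left bracket_add_right a_ac)
    moreover have "(h \<otimes>\<^bsub>L\<^esub> b) \<oplus>\<^bsub>L\<^esub> (x \<otimes>\<^bsub>L\<^esub> k) \<in> I"
      using h k hk x y by (intro ideal_add ideal_bracket_left ideal_bracket_right) auto
    ultimately have "a \<otimes>\<^bsub>L\<^esub> b \<in> I +>\<^bsub>L\<^esub> (x \<otimes>\<^bsub>L\<^esub> y)"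
      using x y by (auto simp: coset_mem_iff)
    then show ?thesis
      using cosets.a_repr_independence' x y by blast
  qed
  moreover have "I +>\<^bsub>L\<^esub> x \<noteq> {}" "I +>\<^bsub>L\<^esub> y \<noteq> {}"
    using x y cosets.a_rcos_self by blast+
  ultimately have "(\<Union>a\<in>I +>\<^bsub>L\<^esub> x. \<Union>b\<in>I +>\<^bsub>L\<^esub> y. I +>\<^bsub>L\<^esub> (a \<otimes>\<^bsub>L\<^esub> b)) = I +>\<^bsub>L\<^esub> (x \<otimes>\<^bsub>L\<^esub> y)"
    by (intro SUP_eq_const)
  then show ?thesis
    by (simp add: lie_quotient_def rcoset_mult_def)
qed

lemma coset_smult:
  assumes x: "x \<in> carrier L"
  shows "c \<odot>\<^bsub>lie_quotient L I\<^esub> (I +>\<^bsub>L\<^esub> x) = I +>\<^bsub>L\<^esub> (c \<odot>\<^bsub>L\<^esub> x)"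
proof -
  have "I +>\<^bsub>L\<^esub> (c \<odot>\<^bsub>L\<^esub> a) = I +>\<^bsub>L\<^esub> (c \<odot>\<^bsub>L\<^esub> x)" if a: "a \<in> I +>\<^bsub>L\<^esub> x" for a
  proof -
    obtain h where h: "h \<in> I" "a = h \<oplus>\<^bsub>L\<^esub> x"
      using a x by (auto simp: coset_mem_iff)
    then have "c \<odot>\<^bsub>L\<^esub> a = (c \<odot>\<^bsub>L\<^esub> h) \<oplus>\<^bsub>L\<^esub> (c \<odot>\<^bsub>L\<^esub> x)"
      using x ideal_carrier by (simp add: smult_r_distr)
    then have "c \<odot>\<^bsub>L\<^esub> a \<in> I +>\<^bsub>L\<^esub> (c \<odot>\<^bsub>L\<^esub> x)"
      using h x ideal_smult by (auto simp: coset_mem_iff)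
    then show ?thesis
      using cosets.a_repr_independence' x by blast
  qed
  moreover have "I +>\<^bsub>L\<^esub> x \<noteq> {}"
    using x cosets.a_rcos_self by blast
  ultimately have "(\<Union>a\<in>I +>\<^bsub>L\<^esub> x. I +>\<^bsub>L\<^esub> (c \<odot>\<^bsub>L\<^esub> a)) = I +>\<^bsub>L\<^esub> (c \<odot>\<^bsub>L\<^esub> x)"
    by (intro SUP_eq_const)
  then show ?thesis
    by (simp add: lie_quotient_def)
qed

text \<open>
  A function that is constant on the cosets has a one-point image on each of them, so
  \<open>\<lambda>X. the_elem (f ` X)\<close> is the function that it induces on the quotient.
\<close>

lemma coset_map:
  assumes const: "\<And>h. h \<in> I \<Longrightarrow> f (h \<oplus>\<^bsub>L\<^esub> x) = f x" and x: "x \<in> carrier L"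
  shows "the_elem (f ` (I +>\<^bsub>L\<^esub> x)) = f x"
proof -
  have "f ` (I +>\<^bsub>L\<^esub> x) = {f x}"
    using const x cosets.a_rcos_self[OF x] by (force simp: coset_mem_iff)
  then show ?thesis by simp
qed

lemma coset_map_hom:
  assumes f: "f \<in> lie_hom L M"
    and const: "\<And>h x. \<lbrakk>h \<in> I; x \<in> carrier L\<rbrakk> \<Longrightarrow> f (h \<oplus>\<^bsub>L\<^esub> x) = f x"
  shows "(\<lambda>X. the_elem (f ` X)) \<in> lie_hom (lie_quotient L I) M"
  by (rule lie_homI)
     (auto simp: quotient_simps coset_add coset_smult coset_bracket coset_map const lie_homD[OF f])

text \<open>
  The first isomorphism theorem, with the kernel condition expressed by the fibres of the map.
\<close>

lemma coset_map_iso: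
  assumes f: "f \<in> lie_hom L M"
    and surj: "f ` carrier L = carrier M"
    and fibres: "\<And>x y. \<lbrakk>x \<in> carrier L; y \<in> carrier L\<rbrakk> \<Longrightarrow> f x = f y \<longleftrightarrow> y \<in> I +>\<^bsub>L\<^esub> x"
  shows "(\<lambda>X. the_elem (f ` X)) \<in> lie_iso (lie_quotient L I) M"
proof -
  have const: "f (h \<oplus>\<^bsub>L\<^esub> x) = f x" if "h \<in> I" "x \<in> carrier L" for h x
  proof -
    have "h \<oplus>\<^bsub>L\<^esub> x \<in> I +>\<^bsub>L\<^esub> x"
      using that by (auto simp: coset_mem_iff)
    then show ?thesis
      using that ideal_carrier fibres[of x "h \<oplus>\<^bsub>L\<^esub> x"] by simp
  qed
  note the_value = coset_map[where f = f, OF const]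
  have "inj_on (\<lambda>X. the_elem (f ` X)) (carrier (lie_quotient L I))"
  proof (rule inj_onI)
    fix X Y
    assume "X \<in> carrier (lie_quotient L I)" "Y \<in> carrier (lie_quotient L I)"
    then obtain x y where xy: "x \<in> carrier L" "y \<in> carrier L"
      and X: "X = I +>\<^bsub>L\<^esub> x" and Y: "Y = I +>\<^bsub>L\<^esub> y"
      by (auto simp: quotient_simps)
    assume "the_elem (f ` X) = the_elem (f ` Y)"
    then have "f x = f y"
      using xy by (simp add: X Y the_value)
    then have "y \<in> I +>\<^bsub>L\<^esub> x"
      using fibres xy by blast
    then show "X = Y"
      unfolding X Y using cosets.a_repr_independence' xy by blast
  qed
  moreover have "(\<lambda>X. the_elem (f ` X)) ` carrier (lie_quotient L I) = carrier M"
    unfolding quotient_simps surj[symmetric] image_image by (rule image_cong) (simp_all add: the_value)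
  moreover have "(\<lambda>X. the_elem (f ` X)) \<in> lie_hom (lie_quotient L I) M"
    by (rule coset_map_hom[OF f const])
  ultimately show ?thesis
    unfolding lie_iso_def bij_betw_def by blast
qed

end

lemma induced_form_coset:
  assumes "lie_algebra_ideal L I" and x: "x \<in> carrier L" and y: "y \<in> carrier L"
    and const: "\<And>h k. \<lbrakk>h \<in> I; k \<in> I\<rbrakk> \<Longrightarrow> \<omega> (h \<oplus>\<^bsub>L\<^esub> x) (k \<oplus>\<^bsub>L\<^esub> y) = \<omega> x y"
  shows "induced_form \<omega> (I +>\<^bsub>L\<^esub> x) (I +>\<^bsub>L\<^esub> y) = \<omega> x y"
proof -
  interpret lie_algebra_ideal L I by fact
  have "x \<in> I +>\<^bsub>L\<^esub> x" "y \<in> I +>\<^bsub>L\<^esub> y"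
    using x y by (simp_all add: cosets.a_rcos_self)
  then show ?thesis
    unfolding induced_form_def using const x y
    by (intro the_equality) (auto simp: coset_mem_iff)
qed

lemma (in lie_algebra_ideal) lie_algebra_restrict: "lie_algebra (L\<lparr>carrier := I\<rparr>)"
proof -
  have "vectorspace class_ring (L\<lparr>carrier := I\<rparr>)"
    using ideal subspace_is_vs unfolding lie_ideal_def by auto
  then show ?thesis
    by (intro lie_algebra.intro lie_algebra_axioms.intro)
       (simp_all add: ideal_carrier ideal_bracket_right bracket_add_left bracket_add_right
         bracket_smult_left bracket_smult_right bracket_alternating jacobi)
qed

section \<open>Splitting over a hyperplane\<close>

text \<open>
  The quotient by a hyperplane \<open>K\<close> is one-dimensional, hence spanned by the class of any \<open>t\<close> outside
  \<open>K\<close>.  Sending that class to the coset \<open>H + t\<close> gives a linear section.  It is a homomorphism because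
  both sides are abelian: \<open>[t, t] = 0\<close>, and \<open>K\<close> contains all brackets.
\<close>

lemma split_exact_hyperplane:
  assumes H: "lie_algebra_ideal L H" and K: "lie_algebra_ideal L K" and HK: "H \<subseteq> K"
    and phi: "linear_functional L \<phi>" and K_def: "K = {x \<in> carrier L. \<phi> x = 0}"
    and t: "t \<in> carrier L" "\<phi> t = 1"
  shows "lie_split_exact (lie_quotient (L\<lparr>carrier := K\<rparr>) H) (\<lambda>X. X)
           (lie_quotient L H) (\<lambda>X. K <+>\<^bsub>L\<^esub> X) (lie_quotient L K)"
proof -
  interpret H: lie_algebra_ideal L H by fact
  interpret K: lie_algebra_ideal L K by fact
  note phi_simps = phi[unfolded linear_functional_def]
  have coset_restrict: "H +>\<^bsub>L\<lparr>carrier := K\<rparr>\<^esub> x = H +>\<^bsub>L\<^esub> x" for x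
    by (simp add: a_r_coset_def')
  have carr: "carrier (lie_quotient (L\<lparr>carrier := K\<rparr>) H) = (\<lambda>x. H +>\<^bsub>L\<^esub> x) ` K"
    by (auto simp: lie_quotient_def A_RCOSETS_def' coset_restrict)
  have ops: "add (lie_quotient (L\<lparr>carrier := K\<rparr>) H) = add (lie_quotient L H)"
    "smult (lie_quotient (L\<lparr>carrier := K\<rparr>) H) = smult (lie_quotient L H)"
    "mult (lie_quotient (L\<lparr>carrier := K\<rparr>) H) = mult (lie_quotient L H)"
    by (auto simp: lie_quotient_def coset_restrict set_add_def' rcoset_mult_def fun_eq_iff)
  have incl: "(\<lambda>X. X) \<in> lie_hom (lie_quotient (L\<lparr>carrier := K\<rparr>) H) (lie_quotient L H)"
    using K.ideal_carrier by (intro lie_homI) (auto simp: carr ops H.quotient_simps)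
  have KH: "K <+>\<^bsub>L\<^esub> H = K"
  proof
    show "K <+>\<^bsub>L\<^esub> H \<subseteq> K"
      using HK K.ideal_add by (auto simp: set_add_def')
    show "K \<subseteq> K <+>\<^bsub>L\<^esub> H"
    proof
      fix x assume x: "x \<in> K"
      then have "x \<oplus>\<^bsub>L\<^esub> \<zero>\<^bsub>L\<^esub> \<in> K <+>\<^bsub>L\<^esub> H"
        unfolding set_add_def' using H.ideal_zero by blast
      then show "x \<in> K <+>\<^bsub>L\<^esub> H"
        using K.ideal_carrier[OF x] by simp
    qed
  qed
  have p_coset: "K <+>\<^bsub>L\<^esub> (H +>\<^bsub>L\<^esub> x) = K +>\<^bsub>L\<^esub> x" if "x \<in> carrier L" for x
    using that KH H.a_setmult_rcos_assoc[of K H x] K.cosets.a_subset H.cosets.a_subset by simp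
  have p: "(\<lambda>X. K <+>\<^bsub>L\<^esub> X) \<in> lie_hom (lie_quotient L H) (lie_quotient L K)"
    by (rule lie_homI)
       (auto simp: H.quotient_simps K.quotient_simps p_coset H.coset_add K.coset_add
         H.coset_smult K.coset_smult H.coset_bracket K.coset_bracket)
  have K_coset: "K +>\<^bsub>L\<^esub> x = K \<longleftrightarrow> x \<in> K" if "x \<in> carrier L" for x
    using K.cosets.a_rcos_const[of x] K.cosets.a_rcos_self[OF that] by auto
  have exact: "(\<lambda>X. X) ` carrier (lie_quotient (L\<lparr>carrier := K\<rparr>) H) =
      {X \<in> carrier (lie_quotient L H). K <+>\<^bsub>L\<^esub> X = \<zero>\<^bsub>lie_quotient L K\<^esub>}"
  proof -
    have "{X \<in> carrier (lie_quotient L H). K <+>\<^bsub>L\<^esub> X = K} =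
        (\<lambda>x. H +>\<^bsub>L\<^esub> x) ` {x \<in> carrier L. K <+>\<^bsub>L\<^esub> (H +>\<^bsub>L\<^esub> x) = K}"
      by (auto simp: H.quotient_simps)
    also have "{x \<in> carrier L. K <+>\<^bsub>L\<^esub> (H +>\<^bsub>L\<^esub> x) = K} = {x \<in> carrier L. x \<in> K}"
      by (simp add: p_coset K_coset cong: conj_cong)
    also have "{x \<in> carrier L. x \<in> K} = K"
      using K.ideal_carrier by blast
    finally show ?thesis
      by (simp add: carr K.quotient_simps)
  qed
  have surj: "(\<lambda>X. K <+>\<^bsub>L\<^esub> X) ` carrier (lie_quotient L H) = carrier (lie_quotient L K)"
    unfolding H.quotient_simps K.quotient_simps image_image by (rule image_cong) (simp_all add: p_coset)
  \<comment> \<open>The section, still as a map on \<open>L\<close>; it is constant on the cosets of \<open>K\<close>.\<close>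
  define s where "s x = H +>\<^bsub>L\<^esub> (\<phi> x \<odot>\<^bsub>L\<^esub> t)" for x
  have cancel: "(- c) \<odot>\<^bsub>L\<^esub> t \<oplus>\<^bsub>L\<^esub> c \<odot>\<^bsub>L\<^esub> t = \<zero>\<^bsub>L\<^esub>" for c
    using H.smult_l_distr[of "- c" c t, symmetric] t by simp
  have decomp: "\<exists>k\<in>K. x = k \<oplus>\<^bsub>L\<^esub> \<phi> x \<odot>\<^bsub>L\<^esub> t" if x: "x \<in> carrier L" for x
  proof
    show "x \<oplus>\<^bsub>L\<^esub> (- \<phi> x) \<odot>\<^bsub>L\<^esub> t \<in> K"
      using x t phi_simps by (simp add: K_def)
    show "x = (x \<oplus>\<^bsub>L\<^esub> (- \<phi> x) \<odot>\<^bsub>L\<^esub> t) \<oplus>\<^bsub>L\<^esub> \<phi> x \<odot>\<^bsub>L\<^esub> t"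
      using x t by (simp add: H.a_assoc cancel)
  qed
  \<comment> \<open>Both arguments lie in \<open>K + \<real>t\<close>, and \<open>K\<close> is an ideal, so only \<open>[t, t]\<close> could leave \<open>K\<close>.\<close>
  have phi_bracket: "\<phi> (x \<otimes>\<^bsub>L\<^esub> y) = 0" if x: "x \<in> carrier L" and y: "y \<in> carrier L" for x y
  proof -
    obtain k where k: "k \<in> K" "x = k \<oplus>\<^bsub>L\<^esub> \<phi> x \<odot>\<^bsub>L\<^esub> t" using decomp[OF x] by blast
    obtain l where l: "l \<in> K" "y = l \<oplus>\<^bsub>L\<^esub> \<phi> y \<odot>\<^bsub>L\<^esub> t" using decomp[OF y] by blast
    let ?x = "\<phi> x \<odot>\<^bsub>L\<^esub> t" and ?y = "\<phi> y \<odot>\<^bsub>L\<^esub> t"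
    have "x \<otimes>\<^bsub>L\<^esub> y = (k \<oplus>\<^bsub>L\<^esub> ?x) \<otimes>\<^bsub>L\<^esub> y" using k by simp
    also have "\<dots> = (k \<otimes>\<^bsub>L\<^esub> y) \<oplus>\<^bsub>L\<^esub> (?x \<otimes>\<^bsub>L\<^esub> y)"
      using k(1) t y K.ideal_carrier by (simp add: H.bracket_add_left)
    also have "?x \<otimes>\<^bsub>L\<^esub> y = ?x \<otimes>\<^bsub>L\<^esub> (l \<oplus>\<^bsub>L\<^esub> ?y)" using l by simp
    also have "\<dots> = ?x \<otimes>\<^bsub>L\<^esub> l"
      using l(1) t K.ideal_carrier
      by (simp add: H.bracket_add_right H.bracket_smult_left H.bracket_smult_right
          H.bracket_alternating)
    finally have "x \<otimes>\<^bsub>L\<^esub> y \<in> K"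
      using k(1) l(1) t y K.ideal_add K.ideal_bracket_left K.ideal_bracket_right by simp
    then show ?thesis by (simp add: K_def)
  qed
  have s: "s \<in> lie_hom L (lie_quotient L H)"
  proof (rule lie_homI)
    fix x y assume xy: "x \<in> carrier L" "y \<in> carrier L"
    show "s x \<in> carrier (lie_quotient L H)"
      using t by (simp add: s_def H.quotient_simps)
    show "s (x \<oplus>\<^bsub>L\<^esub> y) = s x \<oplus>\<^bsub>lie_quotient L H\<^esub> s y"
      using xy t phi_simps H.smult_l_distr[of "\<phi> x" "\<phi> y" t] by (simp add: s_def H.coset_add)
    show "s (x \<otimes>\<^bsub>L\<^esub> y) = s x \<otimes>\<^bsub>lie_quotient L H\<^esub> s y"
      using xy t by (simp add: s_def H.coset_bracket phi_bracket H.bracket_smult_left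
          H.bracket_smult_right H.bracket_alternating)
    show "s (c \<odot>\<^bsub>L\<^esub> x) = c \<odot>\<^bsub>lie_quotient L H\<^esub> s x" for c
      using xy t phi_simps H.smult_assoc1[of c "\<phi> x" t] by (simp add: s_def H.coset_smult)
  qed
  have s_const: "s (h \<oplus>\<^bsub>L\<^esub> x) = s x" if "h \<in> K" "x \<in> carrier L" for h x
    using that phi_simps by (simp add: s_def K_def)
  have sec: "K <+>\<^bsub>L\<^esub> the_elem (s ` X) = X" if X: "X \<in> carrier (lie_quotient L K)" for X
  proof -
    obtain x where x: "x \<in> carrier L" "X = K +>\<^bsub>L\<^esub> x"
      using X by (auto simp: K.quotient_simps)
    then have "K <+>\<^bsub>L\<^esub> the_elem (s ` X) = K +>\<^bsub>L\<^esub> (\<phi> x \<odot>\<^bsub>L\<^esub> t)"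
      using t by (simp add: K.coset_map s_const) (simp add: s_def p_coset)
    also have "\<dots> = K +>\<^bsub>L\<^esub> x"
      using decomp[OF x(1)] t K.cosets.a_repr_independence'[of x "\<phi> x \<odot>\<^bsub>L\<^esub> t"]
      by (auto simp: K.coset_mem_iff)
    finally show ?thesis using x by simp
  qed
  have "\<exists>s\<in>lie_hom (lie_quotient L K) (lie_quotient L H). \<forall>X\<in>carrier (lie_quotient L K). K <+>\<^bsub>L\<^esub> s X = X"
    by (rule bexI[OF _ K.coset_map_hom[OF s s_const]]) (use sec in auto)
  then show ?thesis
    unfolding lie_split_exact_def
    using incl p exact surj by simp
qed

section \<open>Abelian Lie algebras\<close>

lemma dim_linear_bij:
  assumes "vectorspace class_ring V" "vectorspace class_ring W"
    and "f \<in> LinearCombinations.module_hom class_ring V W" "bij_betw f (carrier V) (carrier W)"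
    and "vectorspace.fin_dim class_ring V"
  shows "vectorspace.fin_dim class_ring W"
    and "vectorspace.dim class_ring W = vectorspace.dim class_ring V"
proof -
  interpret linear_map class_ring V W f
    using assms unfolding linear_map_def mod_hom_def mod_hom_axioms_def vectorspace_def by auto
  show "W.fin_dim"
    using surj_fin_dim assms unfolding bij_betw_def by blast
  show "W.dim = V.dim"
    using dim_eq assms unfolding bij_betw_def by metis
qed

lemma vectorspace_mult_update:
  assumes "vectorspace K V"
  shows "vectorspace K (V\<lparr>mult := b\<rparr>)"
proof -
  interpret vectorspace K V by fact
  have "abelian_group (V\<lparr>mult := b\<rparr>)"
    by (rule abelian_groupI) (auto simp: a_ac intro: l_neg)
  then show ?thesis
    by (intro vectorspace.intro Module.module.intro Module.module_axioms.intro)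
       (auto simp: smult_l_distr smult_r_distr smult_assoc1 intro: R.cring_axioms field_axioms)
qed

lemma abelian_lie_simps:
  "carrier (abelian_lie n) = carrier_vec n" "add (abelian_lie n) = (+)"
  "zero (abelian_lie n) = 0\<^sub>v n" "smult (abelian_lie n) = (\<cdot>\<^sub>v)"
  "mult (abelian_lie n) = (\<lambda>x y. 0\<^sub>v n)"
  by (simp_all add: abelian_lie_def module_vec_simps)

lemma lie_algebra_abelian_lie: "lie_algebra (abelian_lie n)"
proof -
  have "vectorspace class_ring (abelian_lie n)"
    unfolding abelian_lie_def by (rule vectorspace_mult_update, rule vec_vs)
  then show ?thesis
    by (intro lie_algebra.intro lie_algebra_axioms.intro) (auto simp: abelian_lie_simps)
qed

lemma dim_abelian_lie:
  "vectorspace.fin_dim class_ring (abelian_lie n)" (is ?A)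
  "vectorspace.dim class_ring (abelian_lie n) = n" (is ?B)
proof -
  interpret V: vec_space "TYPE(real)" n .
  have hom: "(\<lambda>x. x) \<in> LinearCombinations.module_hom class_ring (module_vec TYPE(real) n) (abelian_lie n)"
    by (auto simp: LinearCombinations.module_hom_def abelian_lie_simps module_vec_simps)
  have "bij_betw (\<lambda>x. x) (carrier (module_vec TYPE(real) n)) (carrier (abelian_lie n))"
    by (simp add: abelian_lie_simps module_vec_simps bij_betw_def)
  note * = dim_linear_bij[OF vec_vs _ hom this V.fin_dim]
  show ?A ?B
    using * lie_algebra_abelian_lie[of n] V.dim_is_n
    by (auto simp: lie_algebra_def)
qed

lemma sum_permutes2:
  fixes f :: "(nat \<Rightarrow> nat) \<Rightarrow> real"
  shows "(\<Sum>\<sigma> | \<sigma> permutes {..<2}. f \<sigma>) = f id + f (transpose 0 1)"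
proof -
  have "{..<2} = insert 0 {1::nat}" by auto
  then show ?thesis
    by (simp add: sum_over_permutations_insert permutes_sing)
qed

lemma two_form_power_one:
  "two_form_power \<omega> (Suc 0) v = (\<omega> (v 0) (v 1) - \<omega> (v 1) (v 0)) / 2"
  by (simp add: wedge_def sum_permutes2 sign_swap_id)

lemma symplectic_abelian_lie2: "symplectic_lie_algebra (abelian_lie 2) standard_form2"
proof -
  have "two_form (abelian_lie 2) standard_form2"
    by (auto simp: two_form_def abelian_lie_simps standard_form2_def algebra_simps)
  moreover have "ce_closed2 (abelian_lie 2) standard_form2"
    by (auto simp: ce_closed2_def ce_differential2_def abelian_lie_simps standard_form2_def)
  moreover have "\<exists>v\<in>{..<2 * 1} \<rightarrow> carrier (abelian_lie 2). two_form_power standard_form2 (Suc 0) v \<noteq> 0"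
    by (rule bexI[of _ "unit_vec 2"])
       (simp_all add: two_form_power_one standard_form2_def abelian_lie_simps
         del: two_form_power.simps)
  ultimately show ?thesis
    unfolding symplectic_lie_algebra_def symplectic_form_def
    using lie_algebra_abelian_lie dim_abelian_lie[of 2] by (metis One_nat_def mult_1_right)
qed

section \<open>Reduction to linear functionals\<close>

text \<open>
  The reduction step.  Here \<open>H\<close> is the common kernel of three functionals \<open>\<phi>\<close>, \<open>p\<close>, \<open>q\<close>, and its
  orthogonal \<open>K\<close> is the kernel of \<open>\<phi>\<close>.  Then \<open>\<phi>\<close> identifies the quotient by \<open>K\<close> with \<open>\<real>\<close>, while
  \<open>(p, q)\<close> identifies \<open>K\<close> modulo \<open>H\<close> with \<open>\<real>\<^sup>2\<close>; this quotient is abelian because \<open>H\<close> contains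
  \<open>[K, K]\<close>.  The induced form is \<open>b\<close> times the standard area form, and rescaling \<open>p\<close> by \<open>b\<close> turns the
  identification into a symplectic one.
\<close>

lemma double_extension_hyperplane:
  fixes G :: "(real, 'a) module" and \<phi> p q :: "'a \<Rightarrow> real"
  defines "K \<equiv> {x. x \<in> carrier G \<and> \<phi> x = 0}"
  defines "H \<equiv> {x. x \<in> K \<and> p x = 0 \<and> q x = 0}"
  assumes symp: "symplectic_lie_algebra G \<omega>"
    and lin: "linear_functional G \<phi>" "linear_functional G p" "linear_functional G q"
    and t: "t \<in> carrier G" "\<phi> t = 1"
    and onto: "\<And>a b. \<exists>x\<in>K. p x = a \<and> q x = b"
    and brG: "\<And>x y. \<lbrakk>x \<in> carrier G; y \<in> carrier G\<rbrakk> \<Longrightarrow> x \<otimes>\<^bsub>G\<^esub> y \<in> K"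
    and brK: "\<And>x y. \<lbrakk>x \<in> K; y \<in> K\<rbrakk> \<Longrightarrow> x \<otimes>\<^bsub>G\<^esub> y \<in> H"
    and brH: "\<And>x y. \<lbrakk>x \<in> carrier G; y \<in> H\<rbrakk> \<Longrightarrow> x \<otimes>\<^bsub>G\<^esub> y \<in> H"
    and perp: "perp G \<omega> H = K"
    and form: "\<And>x y. \<lbrakk>x \<in> K; y \<in> K\<rbrakk> \<Longrightarrow> \<omega> x y = b * (p x * q y - q x * p y)"
    and b: "b \<noteq> 0"
  shows "generalized_symplectic_double_extension G \<omega> (abelian_lie 2) standard_form2 (abelian_lie 1)"
proof -
  interpret G: lie_algebra G
    using symp by (simp add: symplectic_lie_algebra_def)
  note lins = lin[unfolded linear_functional_def]
  note zeros = lin[THEN G.functional_zero]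
  have idK: "lie_ideal G K"
    using brG lins zeros by (intro G.lie_idealI) (auto simp: K_def)
  have idH: "lie_ideal G H"
    using brH lins zeros by (intro G.lie_idealI) (auto simp: K_def H_def)
  interpret K: lie_algebra_ideal G K
    by unfold_locales (rule idK)
  interpret H: lie_algebra_ideal G H
    by unfold_locales (rule idH)
  have HK: "H \<subseteq> K"
    by (auto simp: H_def)
  let ?K = "G\<lparr>carrier := K\<rparr>"
  interpret GK: lie_algebra ?K
    by (rule K.lie_algebra_restrict)
  have idHK: "lie_ideal ?K H"
    using HK H.ideal_zero H.ideal_add H.ideal_smult brK
    by (intro GK.lie_idealI) auto
  interpret HK: lie_algebra_ideal ?K H
    by unfold_locales (rule idHK)
  have "isotropic G \<omega> H"
    using HK perp by (simp add: isotropic_def)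
  moreover have "lie_split_exact (lie_quotient ?K H) (\<lambda>X. X)
           (lie_quotient G H) (\<lambda>X. K <+>\<^bsub>G\<^esub> X) (lie_quotient G K)"
    by (rule split_exact_hyperplane[OF H.lie_algebra_ideal_axioms K.lie_algebra_ideal_axioms HK lin(1) _ t])
       (simp add: K_def)
  moreover have "symplectic_isomorphic (lie_quotient ?K H) (induced_form \<omega>) (abelian_lie 2) standard_form2"
  proof -
    define \<pi> where "\<pi> x = vec 2 (\<lambda>i. if i = 0 then b * p x else q x)" for x
    have pi_eq: "\<pi> x = \<pi> y \<longleftrightarrow> p x = p y \<and> q x = q y" for x y
      using b by (auto simp: \<pi>_def vec_eq_iff less_2_cases_iff all_conj_distrib)
    have hom: "\<pi> \<in> lie_hom ?K (abelian_lie 2)"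
    proof (rule lie_homI)
      fix x y assume xy: "x \<in> carrier ?K" "y \<in> carrier ?K"
      then have "x \<otimes>\<^bsub>G\<^esub> y \<in> H" using brK by simp
      then show "\<pi> (x \<otimes>\<^bsub>?K\<^esub> y) = \<pi> x \<otimes>\<^bsub>abelian_lie 2\<^esub> \<pi> y"
        by (auto simp: \<pi>_def abelian_lie_simps H_def)
    qed (use lins in \<open>auto simp: \<pi>_def abelian_lie_simps K_def algebra_simps\<close>)
    have "\<pi> ` K = carrier_vec 2"
    proof
      show "carrier_vec 2 \<subseteq> \<pi> ` K"
      proof
        fix u :: "real vec" assume u: "u \<in> carrier_vec 2"
        obtain x where "x \<in> K" "p x = u $ 0 / b" "q x = u $ 1"
          using onto by blast
        then have "x \<in> K" "\<pi> x = u"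
          using u b by (auto simp: \<pi>_def less_2_cases_iff)
        then show "u \<in> \<pi> ` K" by blast
      qed
    qed (auto simp: \<pi>_def)
    then have surj: "\<pi> ` carrier ?K = carrier (abelian_lie 2)"
      by (simp add: abelian_lie_simps)
    have diff: "y \<oplus>\<^bsub>G\<^esub> (- 1) \<odot>\<^bsub>G\<^esub> x \<in> H \<longleftrightarrow> p x = p y \<and> q x = q y" if "x \<in> K" "y \<in> K" for x y
      using that lins by (auto simp: H_def K_def)
    have fibres: "\<pi> x = \<pi> y \<longleftrightarrow> y \<in> H +>\<^bsub>?K\<^esub> x" if "x \<in> carrier ?K" "y \<in> carrier ?K" for x y
      using that HK.coset_mem_diff[of x y] diff[of x y] by (simp add: pi_eq)
    have shift: "h \<oplus>\<^bsub>G\<^esub> x \<in> K" "p (h \<oplus>\<^bsub>G\<^esub> x) = p x" "q (h \<oplus>\<^bsub>G\<^esub> x) = q x"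
      if h: "h \<in> H" and x: "x \<in> K" for h x
    proof -
      have "h \<in> carrier G" "x \<in> carrier G" "h \<in> K" "p h = 0" "q h = 0"
        using h x by (auto simp: H_def K_def)
      then show "h \<oplus>\<^bsub>G\<^esub> x \<in> K" "p (h \<oplus>\<^bsub>G\<^esub> x) = p x" "q (h \<oplus>\<^bsub>G\<^esub> x) = q x"
        using x K.ideal_add lins by simp_all
    qed
    have val: "the_elem (\<pi> ` (H +>\<^bsub>?K\<^esub> x)) = \<pi> x" if x: "x \<in> K" for x
      by (rule HK.coset_map) (use x shift in \<open>simp_all add: pi_eq\<close>)
    have "standard_form2 (the_elem (\<pi> ` X)) (the_elem (\<pi> ` Y)) = induced_form \<omega> X Y"
      if X: "X \<in> carrier (lie_quotient ?K H)" and Y: "Y \<in> carrier (lie_quotient ?K H)" for X Y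
    proof -
      obtain x where x: "x \<in> K" "X = H +>\<^bsub>?K\<^esub> x"
        using X unfolding HK.quotient_simps by (elim imageE) simp
      obtain y where y: "y \<in> K" "Y = H +>\<^bsub>?K\<^esub> y"
        using Y unfolding HK.quotient_simps by (elim imageE) simp
      have "\<omega> (h \<oplus>\<^bsub>G\<^esub> x) (k \<oplus>\<^bsub>G\<^esub> y) = \<omega> x y" if h: "h \<in> H" and k: "k \<in> H" for h k
        using shift[OF h x(1)] shift[OF k y(1)] x(1) y(1) by (simp add: form)
      then have "induced_form \<omega> X Y = \<omega> x y"
        unfolding x y using x y
        by (intro induced_form_coset HK.lie_algebra_ideal_axioms) simp_all
      also have "\<dots> = standard_form2 (\<pi> x) (\<pi> y)"
        using x y by (simp add: form \<pi>_def standard_form2_def algebra_simps)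
      finally show ?thesis
        using x y by (simp add: val)
    qed
    then show ?thesis
      unfolding symplectic_isomorphic_def
      by (intro bexI[OF _ HK.coset_map_iso[OF hom surj fibres]] ballI)
  qed
  moreover have "lie_isomorphic (lie_quotient G K) (abelian_lie 1)"
  proof -
    define \<psi> where "\<psi> x = vec 1 (\<lambda>_. \<phi> x)" for x
    have psi_eq: "\<psi> x = \<psi> y \<longleftrightarrow> \<phi> x = \<phi> y" for x y
      by (auto simp: \<psi>_def vec_eq_iff)
    have hom: "\<psi> \<in> lie_hom G (abelian_lie 1)"
      using brG lins by (intro lie_homI) (auto simp: \<psi>_def abelian_lie_simps K_def)
    have "u \<in> \<psi> ` carrier G" if "u \<in> carrier_vec 1" for u
    proof
      show "u = \<psi> (u $ 0 \<odot>\<^bsub>G\<^esub> t)"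
        using that t lins by (auto simp: \<psi>_def)
    qed (use t in simp)
    then have surj: "\<psi> ` carrier G = carrier (abelian_lie 1)"
      by (auto simp: abelian_lie_simps) (simp add: \<psi>_def)
    have fibres: "\<psi> x = \<psi> y \<longleftrightarrow> y \<in> K +>\<^bsub>G\<^esub> x" if "x \<in> carrier G" "y \<in> carrier G" for x y
      using that lins by (auto simp: psi_eq K.coset_mem_diff) (auto simp: K_def)
    show ?thesis
      unfolding lie_isomorphic_def using K.coset_map_iso[OF hom surj fibres] by blast
  qed
  ultimately show ?thesis
    unfolding generalized_symplectic_double_extension_def
    using symp symplectic_abelian_lie2 lie_algebra_abelian_lie[of 1] idH idK perp by metis
qed

section \<open>The square of a two-form and the Pfaffian\<close>

lemma sum_permutes4:
  fixes f :: "(nat \<Rightarrow> nat) \<Rightarrow> real"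
  shows "(\<Sum>\<sigma> | \<sigma> permutes {..<4}. f \<sigma>) =
    (\<Sum>i\<in>{0, 1, 2, 3}. \<Sum>j\<in>{1, 2, 3}. \<Sum>k\<in>{2, 3}.
       f (transpose 0 i \<circ> (transpose 1 j \<circ> transpose 2 k)))"
proof -
  have 4: "{..<4} = insert 0 (insert 1 (insert 2 {3::nat}))" by auto
  have 0: "finite {1, 2, 3::nat}" "0 \<notin> {1, 2, 3::nat}"
    and 1: "finite {2, 3::nat}" "1 \<notin> {2, 3::nat}"
    and 2: "finite {3::nat}" "2 \<notin> {3::nat}" by auto
  show ?thesis
    unfolding 4 sum_over_permutations_insert[OF 0] sum_over_permutations_insert[OF 1]
      sum_over_permutations_insert[OF 2] permutes_sing
    by (simp only: comp_id sum.insert sum.empty finite.emptyI finite.insertI empty_iff if_False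
        insert_absorb2 singleton_conv add_0_right not_False_eq_True)
qed

lemma sign_transpose_chain:
  "sign (transpose 0 i \<circ> (transpose 1 j \<circ> transpose 2 k)) =
    (if i = 0 then 1 else - 1) * ((if j = 1 then 1 else - 1) * (if k = 2 then 1 else - 1))" for i j k :: nat
  by (simp only: sign_compose permutation_compose permutation_swap_id sign_swap_id eq_commute)

text \<open>
  Each of the three ways to split \<open>{0, 1, 2, 3}\<close> into two pairs arises from eight permutations.  By
  antisymmetry the eight terms agree, which leaves eight times the Pfaffian of \<open>a\<close>.
\<close>

lemma pfaffian_sum:
  fixes a :: "nat \<Rightarrow> nat \<Rightarrow> real"
  assumes flip: "a 1 0 = - a 0 1" "a 2 0 = - a 0 2" "a 3 0 = - a 0 3"
    "a 2 1 = - a 1 2" "a 3 1 = - a 1 3" "a 3 2 = - a 2 3"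
  shows "(\<Sum>\<sigma> | \<sigma> permutes {..<4}. of_int (sign \<sigma>) * a (\<sigma> 0) (\<sigma> 1) * ((a (\<sigma> 2) (\<sigma> 3) - a (\<sigma> 3) (\<sigma> 2)) / 2))
    = 8 * (a 0 1 * a 2 3 - a 0 2 * a 1 3 + a 0 3 * a 1 2)"
proof -
  define t where "t i j k n = transpose 0 i (transpose 1 j (transpose 2 k n))" for i j k n :: nat
  define f where "f i j k = (if i = 0 then 1 else - 1) * ((if j = 1 then 1 else - 1) * (if k = 2 then 1 else - 1)) *
     a (t i j k 0) (t i j k 1) * ((a (t i j k 2) (t i j k 3) - a (t i j k 3) (t i j k 2)) / 2)" for i j k :: nat
  \<comment> \<open>Tabulating the 24 terms first keeps the rewriting of the whole sum small.\<close>
  have val: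
    "f 0 1 2 = a 0 1 * a 2 3" "f 0 1 3 = a 0 1 * a 2 3"
    "f 0 2 2 = - a 0 2 * a 1 3" "f 0 2 3 = - a 0 2 * a 1 3"
    "f 0 3 2 = a 0 3 * a 1 2" "f 0 3 3 = a 0 3 * a 1 2"
    "f 1 1 2 = a 0 1 * a 2 3" "f 1 1 3 = a 0 1 * a 2 3"
    "f 1 2 2 = a 0 3 * a 1 2" "f 1 2 3 = a 0 3 * a 1 2"
    "f 1 3 2 = - a 0 2 * a 1 3" "f 1 3 3 = - a 0 2 * a 1 3"
    "f 2 1 2 = a 0 3 * a 1 2" "f 2 1 3 = a 0 3 * a 1 2"
    "f 2 2 2 = - a 0 2 * a 1 3" "f 2 2 3 = - a 0 2 * a 1 3"
    "f 2 3 2 = a 0 1 * a 2 3" "f 2 3 3 = a 0 1 * a 2 3"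
    "f 3 1 2 = - a 0 2 * a 1 3" "f 3 1 3 = - a 0 2 * a 1 3"
    "f 3 2 2 = a 0 1 * a 2 3" "f 3 2 3 = a 0 1 * a 2 3"
    "f 3 3 2 = a 0 3 * a 1 2" "f 3 3 3 = a 0 3 * a 1 2"
    by (simp_all add: f_def t_def transpose_def flip[simplified])
  have "(\<Sum>\<sigma> | \<sigma> permutes {..<4}. of_int (sign \<sigma>) * a (\<sigma> 0) (\<sigma> 1) * ((a (\<sigma> 2) (\<sigma> 3) - a (\<sigma> 3) (\<sigma> 2)) / 2))
    = (\<Sum>i\<in>{0, 1, 2, 3}. \<Sum>j\<in>{1, 2, 3}. \<Sum>k\<in>{2, 3}. f i j k)"
    unfolding sum_permutes4 sign_transpose_chain
    by (intro sum.cong refl) (simp add: f_def t_def)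
  also have "\<dots> = 8 * (a 0 1 * a 2 3 - a 0 2 * a 1 3 + a 0 3 * a 1 2)"
    by (simp add: val[simplified])
  finally show ?thesis .
qed

lemma two_form_power_two:
  assumes anti: "\<And>i j. \<lbrakk>i < 4; j < 4\<rbrakk> \<Longrightarrow> \<omega> (v i) (v j) = - \<omega> (v j) (v i)"
  shows "two_form_power \<omega> 2 v =
    2 * (\<omega> (v 0) (v 1) * \<omega> (v 2) (v 3) - \<omega> (v 0) (v 2) * \<omega> (v 1) (v 3) + \<omega> (v 0) (v 3) * \<omega> (v 1) (v 2))"
    (is "_ = ?rhs")
proof -
  have flip: "\<omega> (v 1) (v 0) = - \<omega> (v 0) (v 1)" "\<omega> (v 2) (v 0) = - \<omega> (v 0) (v 2)"
    "\<omega> (v 3) (v 0) = - \<omega> (v 0) (v 3)" "\<omega> (v 2) (v 1) = - \<omega> (v 1) (v 2)"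
    "\<omega> (v 3) (v 1) = - \<omega> (v 1) (v 3)" "\<omega> (v 3) (v 2) = - \<omega> (v 2) (v 3)"
    by (rule anti; simp)+
  have "two_form_power \<omega> 2 v = wedge 2 2 (\<lambda>v. \<omega> (v 0) (v 1)) (two_form_power \<omega> (Suc 0)) v"
    using two_form_power.simps(2)[of \<omega> "Suc 0"] by (simp add: numeral_2_eq_2 del: two_form_power.simps)
  also have "\<dots> = (\<Sum>\<sigma> | \<sigma> permutes {..<4}. of_int (sign \<sigma>) * \<omega> (v (\<sigma> 0)) (v (\<sigma> 1)) *
      ((\<omega> (v (\<sigma> 2)) (v (\<sigma> 3)) - \<omega> (v (\<sigma> 3)) (v (\<sigma> 2))) / 2)) / 4"
    by (simp add: wedge_def two_form_power_one del: two_form_power.simps)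
       (simp add: numeral_2_eq_2 numeral_3_eq_3)
  also have "\<dots> = ?rhs"
    using pfaffian_sum[of "\<lambda>i j. \<omega> (v i) (v j)"] flip by simp
  finally show ?thesis .
qed

text \<open>
  The identity \<open>Pf (M W M\<^sup>T) = Pf W det M\<close> in size four, where \<open>a\<close>, \<open>b\<close>, \<open>c\<close>, \<open>d\<close> are the rows of \<open>M\<close>.
  Both sides are linear in \<open>a\<close>, so it suffices to compare them on the four unit vectors, and the second
  factor on the right is the Laplace expansion of the determinant along the row \<open>a\<close>.
\<close>

lemma pfaffian_congruence:
  fixes W :: "(nat \<Rightarrow> real) \<Rightarrow> (nat \<Rightarrow> real) \<Rightarrow> real"
  assumes W: "\<And>x y. W x y = w01 * (x 0 * y 1 - x 1 * y 0) + w02 * (x 0 * y 2 - x 2 * y 0)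
    + w03 * (x 0 * y 3 - x 3 * y 0) + w12 * (x 1 * y 2 - x 2 * y 1)
    + w13 * (x 1 * y 3 - x 3 * y 1) + w23 * (x 2 * y 3 - x 3 * y 2)"
  defines "minor i j k \<equiv> \<lambda>b c d :: nat \<Rightarrow> real.
    b i * (c j * d k - c k * d j) - b j * (c i * d k - c k * d i) + b k * (c i * d j - c j * d i)"
  shows "W a b * W c d - W a c * W b d + W a d * W b c = (w01 * w23 - w02 * w13 + w03 * w12) *
    (a 0 * minor 1 2 3 b c d - a 1 * minor 0 2 3 b c d + a 2 * minor 0 1 3 b c d - a 3 * minor 0 1 2 b c d)"
    (is "_ = ?pf * _")
proof -
  \<comment> \<open>\<open>R0\<close> to \<open>R3\<close> are \<open>W\<close> with a unit vector as first argument.\<close>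
  define R0 where "R0 y = w01 * y 1 + w02 * y 2 + w03 * y 3" for y :: "nat \<Rightarrow> real"
  define R1 where "R1 y = w12 * y 2 + w13 * y 3 - w01 * y 0" for y :: "nat \<Rightarrow> real"
  define R2 where "R2 y = w23 * y 3 - w02 * y 0 - w12 * y 1" for y :: "nat \<Rightarrow> real"
  define R3 where "R3 y = - w03 * y 0 - w13 * y 1 - w23 * y 2" for y :: "nat \<Rightarrow> real"
  have rows: "W a y = a 0 * R0 y + a 1 * R1 y + a 2 * R2 y + a 3 * R3 y" for y
    by (simp add: W R0_def R1_def R2_def R3_def algebra_simps)
  have 0: "R0 b * W c d - R0 c * W b d + R0 d * W b c = ?pf * minor 1 2 3 b c d"
    by (simp add: W R0_def minor_def algebra_simps)
  have 1: "R1 b * W c d - R1 c * W b d + R1 d * W b c = ?pf * - minor 0 2 3 b c d"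
    by (simp add: W R1_def minor_def algebra_simps)
  have 2: "R2 b * W c d - R2 c * W b d + R2 d * W b c = ?pf * minor 0 1 3 b c d"
    by (simp add: W R2_def minor_def algebra_simps)
  have 3: "R3 b * W c d - R3 c * W b d + R3 d * W b c = ?pf * - minor 0 1 2 b c d"
    by (simp add: W R3_def minor_def algebra_simps)
  have "W a b * W c d - W a c * W b d + W a d * W b c =
      a 0 * (R0 b * W c d - R0 c * W b d + R0 d * W b c) + a 1 * (R1 b * W c d - R1 c * W b d + R1 d * W b c)
    + a 2 * (R2 b * W c d - R2 c * W b d + R2 d * W b c) + a 3 * (R3 b * W c d - R3 c * W b d + R3 d * W b c)"
    unfolding rows by (simp only: algebra_simps)
  then show ?thesis
    unfolding 0 1 2 3 by (simp add: algebra_simps)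
qed

section \<open>Symplectic forms in four coordinates\<close>

text \<open>
  A linear coordinate system on a four-dimensional Lie algebra.  Coordinate functionals, indexed from
  0, let the brackets and forms be computed in the given abstract algebra, so that nothing has to be
  transported along the isomorphism with one of the tables.  The coordinate of \<open>e\<^sub>4\<close> is \<open>X 3\<close>.
\<close>

locale coordinates4 = lie_algebra G for G :: "(real, 'a) module" +
  fixes X :: "nat \<Rightarrow> 'a \<Rightarrow> real"
  assumes coord_linear: "linear_functional G (X i)"
    and coord_eqI: "\<lbrakk>x \<in> carrier G; y \<in> carrier G; \<And>i. i < 4 \<Longrightarrow> X i x = X i y\<rbrakk> \<Longrightarrow> x = y"
    and coord_onto: "\<exists>x\<in>carrier G. \<forall>i<4. X i x = c i"
begin

lemma coord_add: "\<lbrakk>x \<in> carrier G; y \<in> carrier G\<rbrakk> \<Longrightarrow> X i (x \<oplus>\<^bsub>G\<^esub> y) = X i x + X i y"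
  and coord_smult: "x \<in> carrier G \<Longrightarrow> X i (c \<odot>\<^bsub>G\<^esub> x) = c * X i x"
  using coord_linear[of i] unfolding linear_functional_def by auto

text \<open>
  The basis dual to the coordinates: \<open>e j\<close> is the vector that the bracket tables call \<open>e\<^sub>j\<^sub>+\<^sub>1\<close>.
\<close>

definition e :: "nat \<Rightarrow> 'a" where
  "e j = (SOME x. x \<in> carrier G \<and> (\<forall>i<4. X i x = of_bool (i = j)))"

lemma e_carrier [simp]: "e j \<in> carrier G"
  and coord_e [simp]: "i < 4 \<Longrightarrow> X i (e j) = of_bool (i = j)"
proof -
  have "\<exists>x. x \<in> carrier G \<and> (\<forall>i<4. X i x = of_bool (i = j))"
    using coord_onto[of "\<lambda>i. of_bool (i = j)"] by blast
  then have "e j \<in> carrier G \<and> (\<forall>i<4. X i (e j) = of_bool (i = j))"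
    unfolding e_def by (rule someI_ex)
  then show "e j \<in> carrier G" "i < 4 \<Longrightarrow> X i (e j) = of_bool (i = j)"
    by auto
qed

lemma coord_expansion:
  assumes x: "x \<in> carrier G"
  shows "x = X 0 x \<odot>\<^bsub>G\<^esub> e 0 \<oplus>\<^bsub>G\<^esub> (X 1 x \<odot>\<^bsub>G\<^esub> e 1 \<oplus>\<^bsub>G\<^esub> (X 2 x \<odot>\<^bsub>G\<^esub> e 2 \<oplus>\<^bsub>G\<^esub> X 3 x \<odot>\<^bsub>G\<^esub> e 3))"
proof (rule coord_eqI)
  fix i :: nat assume i: "i < 4"
  then have "i = 0 \<or> i = 1 \<or> i = 2 \<or> i = 3" by auto
  then show "X i x = X i (X 0 x \<odot>\<^bsub>G\<^esub> e 0 \<oplus>\<^bsub>G\<^esub> (X 1 x \<odot>\<^bsub>G\<^esub> e 1 \<oplus>\<^bsub>G\<^esub>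
      (X 2 x \<odot>\<^bsub>G\<^esub> e 2 \<oplus>\<^bsub>G\<^esub> X 3 x \<odot>\<^bsub>G\<^esub> e 3)))"
    by (elim disjE) (simp_all add: coord_add coord_smult)
qed (use x in auto)

lemma two_form_coordinates:
  assumes \<omega>: "two_form G \<omega>" and x: "x \<in> carrier G" and y: "y \<in> carrier G"
  shows "\<omega> x y =
      \<omega> (e 0) (e 1) * (X 0 x * X 1 y - X 1 x * X 0 y) + \<omega> (e 0) (e 2) * (X 0 x * X 2 y - X 2 x * X 0 y)
    + \<omega> (e 0) (e 3) * (X 0 x * X 3 y - X 3 x * X 0 y) + \<omega> (e 1) (e 2) * (X 1 x * X 2 y - X 2 x * X 1 y)
    + \<omega> (e 1) (e 3) * (X 1 x * X 3 y - X 3 x * X 1 y) + \<omega> (e 2) (e 3) * (X 2 x * X 3 y - X 3 x * X 2 y)"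
    (is "_ = ?rhs")
proof -
  note \<omega>_simps = \<omega>[unfolded two_form_def]
  have add_left: "\<omega> (x \<oplus>\<^bsub>G\<^esub> y) z = \<omega> x z + \<omega> y z"
    and add_right: "\<omega> z (x \<oplus>\<^bsub>G\<^esub> y) = \<omega> z x + \<omega> z y"
    if "x \<in> carrier G" "y \<in> carrier G" "z \<in> carrier G" for x y z
    using that \<omega>_simps by blast+
  have smult_left: "\<omega> (c \<odot>\<^bsub>G\<^esub> x) z = c * \<omega> x z"
    and smult_right: "\<omega> z (c \<odot>\<^bsub>G\<^esub> x) = c * \<omega> z x"
    if "x \<in> carrier G" "z \<in> carrier G" for x z c
    using that \<omega>_simps by blast+
  have alt: "\<omega> x x = 0" if "x \<in> carrier G" for x
    using that \<omega>_simps by blast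
  have anti: "\<omega> y x = - \<omega> x y" if "x \<in> carrier G" "y \<in> carrier G" for x y
  proof -
    have "0 = \<omega> (x \<oplus>\<^bsub>G\<^esub> y) (x \<oplus>\<^bsub>G\<^esub> y)"
      using that by (simp add: alt)
    also have "\<dots> = \<omega> x (x \<oplus>\<^bsub>G\<^esub> y) + \<omega> y (x \<oplus>\<^bsub>G\<^esub> y)"
      using that by (intro add_left) auto
    also have "\<dots> = \<omega> x y + \<omega> y x"
      using that by (simp add: add_right alt)
    finally show ?thesis by simp
  qed
  note flip = anti[of "e 0" "e 1"] anti[of "e 0" "e 2"] anti[of "e 0" "e 3"]
    anti[of "e 1" "e 2"] anti[of "e 1" "e 3"] anti[of "e 2" "e 3"]
  have "\<omega> x y = \<omega> (X 0 x \<odot>\<^bsub>G\<^esub> e 0 \<oplus>\<^bsub>G\<^esub> (X 1 x \<odot>\<^bsub>G\<^esub> e 1 \<oplus>\<^bsub>G\<^esub> (X 2 x \<odot>\<^bsub>G\<^esub> e 2 \<oplus>\<^bsub>G\<^esub> X 3 x \<odot>\<^bsub>G\<^esub> e 3)))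
     (X 0 y \<odot>\<^bsub>G\<^esub> e 0 \<oplus>\<^bsub>G\<^esub> (X 1 y \<odot>\<^bsub>G\<^esub> e 1 \<oplus>\<^bsub>G\<^esub> (X 2 y \<odot>\<^bsub>G\<^esub> e 2 \<oplus>\<^bsub>G\<^esub> X 3 y \<odot>\<^bsub>G\<^esub> e 3)))"
    using coord_expansion[OF x] coord_expansion[OF y] by simp
  also have "\<dots> = ?rhs"
    by (simp add: add_left add_right smult_left smult_right alt flip[simplified] algebra_simps)
  finally show ?thesis .
qed

end

lemma (in coordinates4) dim_eq_4:
  assumes "vectorspace.fin_dim class_ring G"
  shows "vectorspace.dim class_ring G = 4"
proof -
  interpret V: vec_space "TYPE(real)" 4 .
  define f where "f x = vec 4 (\<lambda>i. X i x)" for x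
  have "inj_on f (carrier G)"
  proof (rule inj_onI, rule coord_eqI)
    fix x y and i :: nat assume "f x = f y" "i < 4"
    then have "f x $ i = f y $ i" by simp
    then show "X i x = X i y" using \<open>i < 4\<close> by (simp add: f_def)
  qed
  moreover have "f ` carrier G = carrier_vec 4"
  proof
    show "carrier_vec 4 \<subseteq> f ` carrier G"
    proof
      fix u :: "real vec" assume u: "u \<in> carrier_vec 4"
      obtain x where "x \<in> carrier G" "\<forall>i<4. X i x = u $ i"
        using coord_onto[of "\<lambda>i. u $ i"] by blast
      moreover from this have "f x = u"
        using u by (intro eq_vecI) (auto simp: f_def)
      ultimately show "u \<in> f ` carrier G" by blast
    qed
  qed (auto simp: f_def)
  ultimately have "bij_betw f (carrier G) (carrier (module_vec TYPE(real) 4))"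
    by (simp add: bij_betw_def module_vec_simps)
  moreover have "f \<in> LinearCombinations.module_hom class_ring G (module_vec TYPE(real) 4)"
    unfolding LinearCombinations.module_hom_def
    by (auto simp: module_vec_simps f_def coord_add coord_smult)
  ultimately show ?thesis
    using dim_linear_bij(2)[OF vectorspace_axioms vec_vs _ _ assms] V.dim_is_n by metis
qed

text \<open>
  In dimension four, \<open>\<omega>\<^sup>2\<close> evaluated on any four vectors is a multiple of the Pfaffian of \<open>\<omega>\<close>, by
  the preceding identity.  So the condition \<open>\<omega>\<^sup>2 \<noteq> 0\<close> becomes a condition on six numbers.
\<close>

lemma (in coordinates4) pfaffian_nonzero:
  assumes symp: "symplectic_form G \<omega>"
  shows "\<omega> (e 0) (e 1) * \<omega> (e 2) (e 3) - \<omega> (e 0) (e 2) * \<omega> (e 1) (e 3) + \<omega> (e 0) (e 3) * \<omega> (e 1) (e 2) \<noteq> 0"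
    (is "?pf \<noteq> 0")
proof
  assume pf: "?pf = 0"
  have \<omega>: "two_form G \<omega>" and fin: "vectorspace.fin_dim class_ring G"
    using symp by (auto simp: symplectic_form_def)
  obtain n v where n: "vectorspace.dim class_ring G = 2 * n"
    and v: "v \<in> {..<2 * n} \<rightarrow> carrier G" and nz: "two_form_power \<omega> n v \<noteq> 0"
    using symp by (auto simp: symplectic_form_def)
  have n2: "n = 2"
    using n dim_eq_4[OF fin] by simp
  have vc: "v i \<in> carrier G" if "i < 4" for i
    using v that n2 by auto
  define W where "W x y = \<omega> (e 0) (e 1) * (x 0 * y 1 - x 1 * y 0) + \<omega> (e 0) (e 2) * (x 0 * y 2 - x 2 * y 0)
    + \<omega> (e 0) (e 3) * (x 0 * y 3 - x 3 * y 0) + \<omega> (e 1) (e 2) * (x 1 * y 2 - x 2 * y 1)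
    + \<omega> (e 1) (e 3) * (x 1 * y 3 - x 3 * y 1) + \<omega> (e 2) (e 3) * (x 2 * y 3 - x 3 * y 2)"
    for x y :: "nat \<Rightarrow> real"
  have coords: "\<omega> (v i) (v j) = W (\<lambda>k. X k (v i)) (\<lambda>k. X k (v j))" if "i < 4" "j < 4" for i j
    unfolding W_def using two_form_coordinates[OF \<omega> vc vc] that .
  have "\<omega> (v i) (v j) = - \<omega> (v j) (v i)" if "i < 4" "j < 4" for i j
    using that by (simp add: coords W_def algebra_simps)
  from two_form_power_two[of \<omega> v, OF this]
  have "two_form_power \<omega> 2 v = 2 *
      (\<omega> (v 0) (v 1) * \<omega> (v 2) (v 3) - \<omega> (v 0) (v 2) * \<omega> (v 1) (v 3) + \<omega> (v 0) (v 3) * \<omega> (v 1) (v 2))"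
    .
  then have "two_form_power \<omega> 2 v = 0"
    by (simp add: coords pfaffian_congruence[OF W_def] pf del: One_nat_def)
  then show False
    using nz n2 by simp
qed

section \<open>The two families\<close>

lemma lie_from_table_simps:
  "carrier (lie_from_table n b) = carrier_vec n" "add (lie_from_table n b) = (+)"
  "smult (lie_from_table n b) = (\<cdot>\<^sub>v)"
  "x \<otimes>\<^bsub>lie_from_table n b\<^esub> y = vec n (\<lambda>k. \<Sum>i=1..n. \<Sum>j=1..n.
        x $ (i - 1) * y $ (j - 1) * (b i j $ k - b j i $ k))"
  by (simp_all add: lie_from_table_def module_vec_simps)

text \<open>
  The coordinate functionals beyond the fourth are zero, which keeps all of them linear.
\<close>

lemma coordinates4_of_iso:
  assumes G: "lie_algebra G" and f: "f \<in> lie_iso G (lie_from_table 4 b)"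
  shows "coordinates4 G (\<lambda>i x. if i < 4 then f x $ i else 0)"
proof -
  interpret lie_algebra G by fact
  have hom: "f \<in> lie_hom G (lie_from_table 4 b)" and bij: "bij_betw f (carrier G) (carrier_vec 4)"
    using f by (auto simp: lie_iso_def lie_from_table_simps)
  have fc: "f x \<in> carrier_vec 4" if "x \<in> carrier G" for x
    using lie_hom_closed[OF hom that] by (simp add: lie_from_table_simps)
  have fd: "dim_vec (f x) = 4" if "x \<in> carrier G" for x
    using fc[OF that] by simp
  show ?thesis
  proof unfold_locales
    show "linear_functional G (\<lambda>x. if i < 4 then f x $ i else 0)" for i
      unfolding linear_functional_def
      by (auto simp: lie_hom_add[OF hom] lie_hom_smult[OF hom] lie_from_table_simps fd)
  next
    fix x y assume xy: "x \<in> carrier G" "y \<in> carrier G"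
      and eq: "\<And>i. i < 4 \<Longrightarrow> (if i < 4 then f x $ i else 0) = (if i < 4 then f y $ i else 0)"
    have "f x = f y"
      using fc[OF xy(1)] fc[OF xy(2)] eq by (intro eq_vecI) auto
    then show "x = y"
      using bij xy by (auto simp: bij_betw_def inj_on_def)
  next
    fix c :: "nat \<Rightarrow> real"
    have "vec 4 c \<in> f ` carrier G"
      using bij by (simp add: bij_betw_def)
    then obtain x where "x \<in> carrier G" "f x = vec 4 c"
      by (metis imageE)
    then show "\<exists>x\<in>carrier G. \<forall>i<4. (if i < 4 then f x $ i else 0) = c i"
      by (intro bexI[of _ x]) simp_all
  qed
qed

lemma sum_1_to_4: "(\<Sum>i=1..4. g i) = g 1 + g 2 + g 3 + g (4::nat)" for g :: "nat \<Rightarrow> real"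
  by (simp add: eval_nat_numeral)

lemma bracket_r'_4_0:
  shows "(x \<otimes>\<^bsub>r'_4_0 \<delta>\<^esub> y) $ 0 = x $ 3 * y $ 0 - x $ 0 * y $ 3"
    and "(x \<otimes>\<^bsub>r'_4_0 \<delta>\<^esub> y) $ 1 = \<delta> * (x $ 3 * y $ 2 - x $ 2 * y $ 3)"
    and "(x \<otimes>\<^bsub>r'_4_0 \<delta>\<^esub> y) $ 2 = - \<delta> * (x $ 3 * y $ 1 - x $ 1 * y $ 3)"
    and "(x \<otimes>\<^bsub>r'_4_0 \<delta>\<^esub> y) $ 3 = 0"
  unfolding r'_4_0_def lie_from_table_simps sum_1_to_4 basis4_def
  by (simp_all add: algebra_simps)

lemma bracket_d'_4:
  shows "(x \<otimes>\<^bsub>d'_4 \<delta>\<^esub> y) $ 0 = \<delta> / 2 * (x $ 3 * y $ 0 - x $ 0 * y $ 3) + (x $ 3 * y $ 1 - x $ 1 * y $ 3)"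
    and "(x \<otimes>\<^bsub>d'_4 \<delta>\<^esub> y) $ 1 = \<delta> / 2 * (x $ 3 * y $ 1 - x $ 1 * y $ 3) - (x $ 3 * y $ 0 - x $ 0 * y $ 3)"
    and "(x \<otimes>\<^bsub>d'_4 \<delta>\<^esub> y) $ 2 = x $ 0 * y $ 1 - x $ 1 * y $ 0 + \<delta> * (x $ 3 * y $ 2 - x $ 2 * y $ 3)"
    and "(x \<otimes>\<^bsub>d'_4 \<delta>\<^esub> y) $ 3 = 0"
  unfolding d'_4_def lie_from_table_simps sum_1_to_4 basis4_def
  by (simp_all add: algebra_simps)

lemma ce_closed2D:
  assumes "ce_closed2 L \<omega>" "x \<in> carrier L" "y \<in> carrier L" "z \<in> carrier L"
  shows "\<omega> (x \<otimes>\<^bsub>L\<^esub> y) z - \<omega> (x \<otimes>\<^bsub>L\<^esub> z) y + \<omega> (y \<otimes>\<^bsub>L\<^esub> z) x = 0"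
proof -
  have "ce_differential2 L \<omega> x y z = 0"
    using assms by (simp add: ce_closed2_def)
  then show ?thesis
    by (simp add: ce_differential2_def)
qed

context coordinates4
begin

text \<open>
  Closedness on \<open>(e\<^sub>4, e\<^sub>1, e\<^sub>2)\<close> and \<open>(e\<^sub>4, e\<^sub>1, e\<^sub>3)\<close> gives a linear system for \<open>\<omega>(e\<^sub>1, e\<^sub>2)\<close> and
  \<open>\<omega>(e\<^sub>1, e\<^sub>3)\<close> with determinant \<open>1 + \<delta>\<^sup>2\<close>, so both vanish.  The Pfaffian is then
  \<open>\<omega>(e\<^sub>1, e\<^sub>4) \<omega>(e\<^sub>2, e\<^sub>3)\<close>.  Hence the orthogonal of \<open>\<real>e\<^sub>1\<close> is the span of \<open>e\<^sub>1\<close>, \<open>e\<^sub>2\<close>, \<open>e\<^sub>3\<close>, an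
  abelian ideal, and \<open>\<omega>\<close> induces a nonzero area form on the classes of \<open>e\<^sub>2\<close> and \<open>e\<^sub>3\<close>.
\<close>

lemma double_extension_r'_4_0:
  assumes symp: "symplectic_lie_algebra G \<omega>"
    and br: "\<And>x y. \<lbrakk>x \<in> carrier G; y \<in> carrier G\<rbrakk> \<Longrightarrow> X 0 (x \<otimes>\<^bsub>G\<^esub> y) = X 3 x * X 0 y - X 0 x * X 3 y"
      "\<And>x y. \<lbrakk>x \<in> carrier G; y \<in> carrier G\<rbrakk> \<Longrightarrow> X 1 (x \<otimes>\<^bsub>G\<^esub> y) = \<delta> * (X 3 x * X 2 y - X 2 x * X 3 y)"
      "\<And>x y. \<lbrakk>x \<in> carrier G; y \<in> carrier G\<rbrakk> \<Longrightarrow> X 2 (x \<otimes>\<^bsub>G\<^esub> y) = - \<delta> * (X 3 x * X 1 y - X 1 x * X 3 y)"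
      "\<And>x y. \<lbrakk>x \<in> carrier G; y \<in> carrier G\<rbrakk> \<Longrightarrow> X 3 (x \<otimes>\<^bsub>G\<^esub> y) = 0"
  shows "generalized_symplectic_double_extension G \<omega> (abelian_lie 2) standard_form2 (abelian_lie 1)"
proof -
  have form: "symplectic_form G \<omega>" "two_form G \<omega>" "ce_closed2 G \<omega>"
    using symp by (auto simp: symplectic_lie_algebra_def symplectic_form_def)
  define w where "w i j = \<omega> (e i) (e j)" for i j
  note coords = two_form_coordinates[OF form(2), folded w_def]
  have c01: "w 0 1 = \<delta> * w 0 2"
    using ce_closed2D[OF form(3), of "e 3" "e 0" "e 1"]
    by (simp add: coords br algebra_simps del: One_nat_def)
  have "w 0 2 + \<delta> * w 0 1 = 0"
    using ce_closed2D[OF form(3), of "e 3" "e 0" "e 2"]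
    by (simp add: coords br algebra_simps del: One_nat_def)
  then have "(1 + \<delta>\<^sup>2) * w 0 2 = 0"
    unfolding c01 by (simp add: algebra_simps power2_eq_square)
  then have w: "w 0 2 = 0" "w 0 1 = 0"
    using c01 by (auto simp: add_nonneg_eq_0_iff)
  then have nz: "w 0 3 \<noteq> 0" "w 1 2 \<noteq> 0"
    using pfaffian_nonzero[OF form(1), folded w_def] by auto
  have \<omega>: "\<omega> x y = w 0 3 * (X 0 x * X 3 y - X 3 x * X 0 y) + w 1 2 * (X 1 x * X 2 y - X 2 x * X 1 y)
      + w 1 3 * (X 1 x * X 3 y - X 3 x * X 1 y) + w 2 3 * (X 2 x * X 3 y - X 3 x * X 2 y)"
    if "x \<in> carrier G" "y \<in> carrier G" for x y
    using coords[OF that] w by simp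
  show ?thesis
  proof (rule double_extension_hyperplane[where \<phi> = "X 3" and p = "X 1" and q = "X 2"
        and t = "e 3" and b = "w 1 2"])
    show "perp G \<omega> {x. x \<in> {x. x \<in> carrier G \<and> X 3 x = 0} \<and> X 1 x = 0 \<and> X 2 x = 0} = {x. x \<in> carrier G \<and> X 3 x = 0}"
      (is "perp G \<omega> ?H = ?K")
    proof
      show "perp G \<omega> ?H \<subseteq> ?K"
      proof
        fix x assume x: "x \<in> perp G \<omega> ?H"
        then have "x \<in> carrier G" "\<omega> x (e 0) = 0"
          by (auto simp: perp_def)
        then show "x \<in> ?K"
          using nz by (simp add: \<omega>)
      qed
    qed (auto simp: perp_def \<omega>)
    show "\<exists>x\<in>{x. x \<in> carrier G \<and> X 3 x = 0}. X 1 x = a \<and> X 2 x = b" for a b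
      using coord_onto[of "\<lambda>i. if i = 1 then a else if i = 2 then b else 0"] by force
  qed (use symp nz in \<open>auto simp: coord_linear br \<omega> simp del: One_nat_def\<close>)
qed

text \<open>
  Closedness on \<open>(e\<^sub>4, e\<^sub>1, e\<^sub>3)\<close> and \<open>(e\<^sub>4, e\<^sub>2, e\<^sub>3)\<close> forces \<open>\<omega>(e\<^sub>1, e\<^sub>3)\<close> and \<open>\<omega>(e\<^sub>2, e\<^sub>3)\<close> to vanish,
  and the Pfaffian becomes \<open>\<omega>(e\<^sub>1, e\<^sub>2) \<omega>(e\<^sub>3, e\<^sub>4)\<close>.  Hence the orthogonal of \<open>\<real>e\<^sub>3\<close> is the span of
  \<open>e\<^sub>1\<close>, \<open>e\<^sub>2\<close>, \<open>e\<^sub>3\<close>, a Heisenberg ideal with centre \<open>\<real>e\<^sub>3\<close>, and \<open>\<omega>\<close> induces a nonzero area form on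
  the classes of \<open>e\<^sub>1\<close> and \<open>e\<^sub>2\<close>.
\<close>

lemma double_extension_d'_4:
  assumes symp: "symplectic_lie_algebra G \<omega>"
    and br: "\<And>x y. \<lbrakk>x \<in> carrier G; y \<in> carrier G\<rbrakk> \<Longrightarrow>
        X 0 (x \<otimes>\<^bsub>G\<^esub> y) = \<delta> / 2 * (X 3 x * X 0 y - X 0 x * X 3 y) + (X 3 x * X 1 y - X 1 x * X 3 y)"
      "\<And>x y. \<lbrakk>x \<in> carrier G; y \<in> carrier G\<rbrakk> \<Longrightarrow>
        X 1 (x \<otimes>\<^bsub>G\<^esub> y) = \<delta> / 2 * (X 3 x * X 1 y - X 1 x * X 3 y) - (X 3 x * X 0 y - X 0 x * X 3 y)"
      "\<And>x y. \<lbrakk>x \<in> carrier G; y \<in> carrier G\<rbrakk> \<Longrightarrow>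
        X 2 (x \<otimes>\<^bsub>G\<^esub> y) = X 0 x * X 1 y - X 1 x * X 0 y + \<delta> * (X 3 x * X 2 y - X 2 x * X 3 y)"
      "\<And>x y. \<lbrakk>x \<in> carrier G; y \<in> carrier G\<rbrakk> \<Longrightarrow> X 3 (x \<otimes>\<^bsub>G\<^esub> y) = 0"
  shows "generalized_symplectic_double_extension G \<omega> (abelian_lie 2) standard_form2 (abelian_lie 1)"
proof -
  have form: "symplectic_form G \<omega>" "two_form G \<omega>" "ce_closed2 G \<omega>"
    using symp by (auto simp: symplectic_lie_algebra_def symplectic_form_def)
  define w where "w i j = \<omega> (e i) (e j)" for i j
  note coords = two_form_coordinates[OF form(2), folded w_def]
  have c02: "w 1 2 = 3 * \<delta> / 2 * w 0 2"
    using ce_closed2D[OF form(3), of "e 3" "e 0" "e 2"] by (simp add: coords br field_simps del: One_nat_def)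
  have "w 0 2 + 3 * \<delta> / 2 * w 1 2 = 0"
    using ce_closed2D[OF form(3), of "e 3" "e 1" "e 2"] by (simp add: coords br field_simps del: One_nat_def)
  then have "(1 + (3 * \<delta> / 2)\<^sup>2) * w 0 2 = 0"
    unfolding c02 by (simp add: algebra_simps power2_eq_square)
  then have w: "w 0 2 = 0" "w 1 2 = 0"
    using c02 by (auto simp: add_nonneg_eq_0_iff)
  then have nz: "w 0 1 \<noteq> 0" "w 2 3 \<noteq> 0"
    using pfaffian_nonzero[OF form(1), folded w_def] by auto
  have \<omega>: "\<omega> x y = w 0 1 * (X 0 x * X 1 y - X 1 x * X 0 y) + w 0 3 * (X 0 x * X 3 y - X 3 x * X 0 y)
      + w 1 3 * (X 1 x * X 3 y - X 3 x * X 1 y) + w 2 3 * (X 2 x * X 3 y - X 3 x * X 2 y)"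
    if "x \<in> carrier G" "y \<in> carrier G" for x y
    using coords[OF that] w by simp
  show ?thesis
  proof (rule double_extension_hyperplane[where \<phi> = "X 3" and p = "X 0" and q = "X 1"
        and t = "e 3" and b = "w 0 1"])
    show "perp G \<omega> {x. x \<in> {x. x \<in> carrier G \<and> X 3 x = 0} \<and> X 0 x = 0 \<and> X 1 x = 0} = {x. x \<in> carrier G \<and> X 3 x = 0}"
      (is "perp G \<omega> ?H = ?K")
    proof
      show "perp G \<omega> ?H \<subseteq> ?K"
      proof
        fix x assume x: "x \<in> perp G \<omega> ?H"
        then have "x \<in> carrier G" "\<omega> x (e 2) = 0"
          by (auto simp: perp_def)
        then show "x \<in> ?K"
          using nz by (simp add: \<omega>)
      qed
    qed (auto simp: perp_def \<omega>)
    show "\<exists>x\<in>{x. x \<in> carrier G \<and> X 3 x = 0}. X 0 x = a \<and> X 1 x = b" for a b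
      using coord_onto[of "\<lambda>i. if i = 0 then a else if i = 1 then b else 0"] by force
  qed (use symp nz in \<open>auto simp: coord_linear br \<omega> simp del: One_nat_def\<close>)
qed

end

theorem proposition3p18:
  fixes G :: "(real, 'a) module" and \<omega> :: "'a \<Rightarrow> 'a \<Rightarrow> real"
  assumes "symplectic_lie_algebra G \<omega>"
    and "\<exists>\<delta>>0. lie_isomorphic G (r'_4_0 \<delta>) \<or> lie_isomorphic G (d'_4 \<delta>)"
  shows "generalized_symplectic_double_extension G \<omega> (abelian_lie 2) standard_form2 (abelian_lie 1)"
proof -
  have G: "lie_algebra G"
    using assms(1) by (simp add: symplectic_lie_algebra_def)
  obtain \<delta> f where f: "f \<in> lie_iso G (r'_4_0 \<delta>) \<or> f \<in> lie_iso G (d'_4 \<delta>)"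
    using assms(2) unfolding lie_isomorphic_def by blast
  from f show ?thesis
  proof
    assume f: "f \<in> lie_iso G (r'_4_0 \<delta>)"
    then have "f \<in> lie_hom G (r'_4_0 \<delta>)"
      by (simp add: lie_iso_def)
    note bracket = lie_hom_bracket[OF this]
    interpret coordinates4 G "\<lambda>i x. if i < 4 then f x $ i else 0"
      using coordinates4_of_iso[OF G] f unfolding r'_4_0_def by blast
    show ?thesis
      by (rule double_extension_r'_4_0[where \<delta> = \<delta>, OF assms(1)]) (simp_all add: bracket bracket_r'_4_0[simplified])
  next
    assume f: "f \<in> lie_iso G (d'_4 \<delta>)"
    then have "f \<in> lie_hom G (d'_4 \<delta>)"
      by (simp add: lie_iso_def)
    note bracket = lie_hom_bracket[OF this]
    interpret coordinates4 G "\<lambda>i x. if i < 4 then f x $ i else 0"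
      using coordinates4_of_iso[OF G] f unfolding d'_4_def by blast
    show ?thesis
      by (rule double_extension_d'_4[where \<delta> = \<delta>, OF assms(1)]) (simp_all add: bracket bracket_d'_4[simplified])
  qed
qed

end
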